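(* Let $n\ge1$ be an integer and $\alpha\in(0,\infty)$. (1) Let $a_\alpha>0$ be a constant such that $$\|g-1\|_{W^{1,1}(\mathbb{R},d\gamma)}\le a_\alpha\left(\delta(g)^{1/4}+\delta(g)^{3/4}\right)$$ for every $g\ge0$ on $\mathbb{R}$ with $\sqrt g\in W^{1,2}(\mathbb{R},d\gamma)$, $\int_{\mathbb{R}} g\,d\gamma=1$, $\int_{\mathbb{R}} xg\,d\gamma=0$ and $\int_{\mathbb{R}}|x|^2g\,d\gamma\le\alpha$. Let $f(x_1,\dots,x_n)=\prod_{k=1}^n f_k(x_k)$, where for each $k$, $f_k\ge0$ is a function on $\mathbb{R}$ with $\sqrt{f_k}\in W^{1,2}(\mathbb{R},d\gamma)$, $\int_{\mathbb{R}} f_k\,d\gamma=1$, $\int_{\mathbb{R}} xf_k\,d\gamma=0$ and $\int_{\mathbb{R}}|x|^2f_k\,d\gamma\le\alpha$. Then $$\|f-1\|_{W^{1,1}(\mathbb{R}^n,d\gamma)}\le a_\alpha\, n^{3/4}\left(\delta(f)^{1/4}+\delta(f)^{3/4}\right).$$ (2) Let $\overline a_\alpha>0$ be a constant such that $$\|v-1\|_{W^{1,1}(\mathbb{R},e^{-\pi|x|^2}dx)}\le\overline a_\alpha\left(\delta_*(v)^{1/4}+\delta_*(v)\right)$$ for every $v\ge0$ in $W^{1,2}(\mathbb{R},e^{-\pi|x|^2}dx)$ with $\int_{\mathbb{R}} |v|^2e^{-\pi|x|^2}dx=1$, $\int_{\mathbb{R}} x|v|^2e^{-\pi|x|^2}dx=0$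 and $\int_{\mathbb{R}}|x|^2|v|^2e^{-\pi|x|^2}dx\le\alpha$. Let $u(x_1,\dots,x_n)=\prod_{k=1}^n u_k(x_k)$, where for each $k$, $u_k\ge0$ is in $W^{1,2}(\mathbb{R},e^{-\pi|x|^2}dx)$ with $\int_{\mathbb{R}} |u_k|^2e^{-\pi|x_k|^2}dx_k=1$, $\int_{\mathbb{R}} x_k|u_k|^2e^{-\pi|x_k|^2}dx_k=0$ and $\int_{\mathbb{R}}|x_k|^2|u_k(x_k)|^2e^{-\pi|x_k|^2}dx_k\le\alpha$. Then $$\|u-1\|_{W^{1,1}(\mathbb{R}^n,e^{-\pi|x|^2}dx)}\le n\,\overline a_\alpha\left(\delta_*(u)^{1/4}+\delta_*(u)\right).$$
   Context: $d\gamma=(2\pi)^{-d/2}e^{-|x|^2/2}dx$ is the standard Gaussian measure on $\mathbb{R}^d$ (the dimension $d=1$ or $d=n$ being that of the space indicated). The logarithmic Sobolev deficit of a normalized $f\ge0$ is $$\delta(f)=\frac12\int\frac{|\nabla f|^2}{f}\,d\gamma-\int f\log f\,d\gamma ,$$ which is nonnegative (with $0\log 0=0$, and $|\nabla f|^2/f=4|\nabla\sqrt f|^2$). The quantity $\delta_*(u)$ is defined by $$\pi\,\delta_*(u)=\int|\nabla u|^2e^{-\pi|x|^2}dx-\pi\int|u|^2\ln|u|^2\,e^{-\pi|x|^2}dx .$$ In both definitions the integrals are over the space on which the function lives. For a measure $\mu$ on $\mathbb{R}^d$, $\|g\|_{W^{1,1}(\mathbb{R}^d,\mu)}=\int|g|\,d\mu+\int|\nabla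 g|\,d\mu$, with weak gradient and Euclidean norm. $W^{1,2}(\mathbb{R}^d,\mu)$ is the Sobolev space of functions $g$ with $\int (|g|^2+|\nabla g|^2)\,d\mu<\infty$. One-dimensional constants $a_\alpha$ and $\overline a_\alpha$ with the stated properties exist for every $\alpha$. *)

theory Defs
  imports "HOL-Analysis.Analysis"
begin

text \<open>
  Everything is stated over a type of class \<open>euclidean_space\<close>, so that the line is
  the type \<open>real\<close> and Euclidean \<open>n\<close>-space is \<open>real ^ 'n\<close>.
\<close>

primrec Ck :: "nat \<Rightarrow> ('a::euclidean_space \<Rightarrow> real) \<Rightarrow> bool" where
  "Ck 0 \<phi> \<longleftrightarrow> continuous_on UNIV \<phi>"
| "Ck (Suc k) \<phi> \<longleftrightarrow> (\<forall>x. \<phi> differentiable (at x)) \<and>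
     (\<forall>b\<in>Basis. Ck k (\<lambda>x. frechet_derivative \<phi> (at x) b))"

definition test_function :: "('a::euclidean_space \<Rightarrow> real) \<Rightarrow> bool" where
  "test_function \<phi> \<longleftrightarrow> (\<forall>k. Ck k \<phi>) \<and> compact (closure {x. \<phi> x \<noteq> 0})"

definition locally_integrable :: "('a::euclidean_space \<Rightarrow> 'b::euclidean_space) \<Rightarrow> bool" where
  "locally_integrable g \<longleftrightarrow> g \<in> borel_measurable borel \<and>
     (\<forall>K. compact K \<longrightarrow> set_integrable lborel K g)"

text \<open>
  Weak derivatives are taken in the sense of distributions, hence with respect to Lebesgue
  measure, also when norms are computed with a weighted measure.
\<close>

definition has_weak_gradient ::
  "('a::euclidean_space \<Rightarrow> real) \<Rightarrow> ('a \<Rightarrow> 'a) \<Rightarrow> bool" where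
  "has_weak_gradient g G \<longleftrightarrow> locally_integrable g \<and> locally_integrable G \<and>
     (\<forall>\<phi>. test_function \<phi> \<longrightarrow> (\<forall>b\<in>Basis.
        (\<integral>x. g x * frechet_derivative \<phi> (at x) b \<partial>lborel) = - (\<integral>x. (G x \<bullet> b) * \<phi> x \<partial>lborel)))"

definition weakly_differentiable :: "('a::euclidean_space \<Rightarrow> real) \<Rightarrow> bool" where
  "weakly_differentiable g \<longleftrightarrow> (\<exists>G. has_weak_gradient g G)"

text \<open>
  The weak gradient is determined only up to a Lebesgue null set; it is used below only inside
  integrals. It is an unspecified function if \<open>g\<close> is not weakly differentiable.
\<close>

definition weak_gradient :: "('a::euclidean_space \<Rightarrow> real) \<Rightarrow> 'a \<Rightarrow> 'a" where
  "weak_gradient g = (SOME G. has_weak_gradient g G)"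

definition in_W12 :: "'a::euclidean_space measure \<Rightarrow> ('a \<Rightarrow> real) \<Rightarrow> bool" where
  "in_W12 \<mu> g \<longleftrightarrow> weakly_differentiable g \<and> integrable \<mu> (\<lambda>x. (g x)\<^sup>2) \<and>
     integrable \<mu> (\<lambda>x. (norm (weak_gradient g x))\<^sup>2)"

text \<open>
  The norm takes the value \<open>\<infinity>\<close> outside the Sobolev space, so that a finite bound on it
  includes membership in the space.
\<close>

definition W11_norm :: "'a::euclidean_space measure \<Rightarrow> ('a \<Rightarrow> real) \<Rightarrow> ennreal" where
  "W11_norm \<mu> g =
     (if weakly_differentiable g
      then (\<integral>\<^sup>+x. ennreal \<bar>g x\<bar> \<partial>\<mu>) + (\<integral>\<^sup>+x. ennreal (norm (weak_gradient g x)) \<partial>\<mu>)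
      else \<infinity>)"

definition gauss :: "'a::euclidean_space measure" where
  "gauss = density lborel
     (\<lambda>x. ennreal ((2 * pi) powr (- (real DIM('a) / 2)) * exp (- (norm x)\<^sup>2 / 2)))"

definition gauss_pi :: "'a::euclidean_space measure" where
  "gauss_pi = density lborel (\<lambda>x. ennreal (exp (- pi * (norm x)\<^sup>2)))"

text \<open>
  The conventions \<open>0 log 0 = 0\<close> and (where \<open>f = 0\<close>) \<open>|\<nabla>f|\<^sup>2 / f = 0 = 4 |\<nabla>\<surd>f|\<^sup>2\<close> are
  built in: multiplication by \<open>0\<close> and division by \<open>0\<close> give \<open>0\<close>.
\<close>

definition deficit :: "('a::euclidean_space \<Rightarrow> real) \<Rightarrow> real" where
  "deficit f = 1 / 2 * (\<integral>x. (norm (weak_gradient f x))\<^sup>2 / f x \<partial>gauss)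
     - (\<integral>x. f x * ln (f x) \<partial>gauss)"

definition deficit_star :: "('a::euclidean_space \<Rightarrow> real) \<Rightarrow> real" where
  "deficit_star u = ((\<integral>x. (norm (weak_gradient u x))\<^sup>2 \<partial>gauss_pi)
     - pi * (\<integral>x. \<bar>u x\<bar>\<^sup>2 * ln (\<bar>u x\<bar>\<^sup>2) \<partial>gauss_pi)) / pi"

text \<open>
  The second moment is a nonnegative integral: the Bochner integral of a non-integrable
  function is \<open>0\<close> and would satisfy the bound vacuously. This bound makes the first moment
  an absolutely convergent integral.
\<close>

definition centered_density :: "real measure \<Rightarrow> real \<Rightarrow> (real \<Rightarrow> real) \<Rightarrow> bool" where
  "centered_density \<mu> \<alpha> w \<longleftrightarrow> (\<integral>x. w x \<partial>\<mu>) = 1 \<and> (\<integral>x. x * w x \<partial>\<mu>) = 0 \<and>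
     (\<integral>\<^sup>+x. ennreal (\<bar>x\<bar>\<^sup>2 * w x) \<partial>\<mu>) \<le> ennreal \<alpha>"

definition class_f :: "real \<Rightarrow> (real \<Rightarrow> real) \<Rightarrow> bool" where
  "class_f \<alpha> g \<longleftrightarrow> (\<forall>x. 0 \<le> g x) \<and> in_W12 gauss (\<lambda>x. sqrt (g x)) \<and>
     centered_density gauss \<alpha> g"

definition class_u :: "real \<Rightarrow> (real \<Rightarrow> real) \<Rightarrow> bool" where
  "class_u \<alpha> v \<longleftrightarrow> (\<forall>x. 0 \<le> v x) \<and> in_W12 gauss_pi v \<and>
     centered_density gauss_pi \<alpha> (\<lambda>x. \<bar>v x\<bar>\<^sup>2)"

end

theory Submission
  imports Defs "HOL-Probability.Distributions" "HOL-Computational_Algebra.Polynomial"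
begin

text \<open>
  Both deficits are additive on products: the logarithm turns the product into a sum, the
  Fisher information splits in the same way, and the factors that are not differentiated
  integrate to 1. The \<open>W\<^sup>1\<^sup>,\<^sup>1\<close> norm is subadditive: for
  nonnegative factors of integral at most 1, \<open>\<parallel>\<Prod>f\<^sub>k - 1\<parallel>\<close> is at most \<open>\<Sum>\<parallel>f\<^sub>k - 1\<parallel>\<close>, by
  telescoping for the functions and by the triangle inequality for the gradients. Applying the
  one-dimensional bound to every factor, what remains is to compare \<open>\<Sum>\<delta>\<^sub>k\<^sup>s\<close> with
  \<open>(\<Sum>\<delta>\<^sub>k)\<^sup>s\<close>: the power mean inequality gives the factor \<open>n\<^sup>3\<^sup>/\<^sup>4\<close> for \<open>s = 1/4\<close> and
  \<open>s = 3/4\<close>, and monotonicity gives the factor \<open>n\<close> in the second part. The carrying lemmas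
  are \<open>has_weak_gradient_tensor\<close>, \<open>W11_norm_tensor_minus_1\<close>, \<open>deficit_tensor\<close> and
  \<open>deficit_star_tensor\<close>.

  Three points need an argument. The first is that weak gradients of products can be computed at
  all: a weak gradient is only determined up to null sets, which requires enough test functions,
  and these are built from \<open>exp (-1/x)\<close>.

  The second is that the deficit is a difference of two integrals, so that additivity needs the
  entropy integral of each factor to be finite. In one dimension with a finite second moment this
  is elementary: if \<open>w\<close> is in the Sobolev space of the Gaussian measure with density \<open>\<rho>\<close>, then
  the derivative of \<open>w\<^sup>2 \<rho>\<close> is integrable, hence \<open>w\<^sup>2 \<rho>\<close> is bounded and \<open>ln (w\<^sup>2)\<close> grows at
  most quadratically. It rests on the product rule for weakly differentiable functions on the line,
  which holds because these are indefinite integrals.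

  The third is that the deficits of the factors are nonnegative. Instead of the logarithmic Sobolev
  inequality one can use the assumed one-dimensional bound itself: if the deficit were negative, the
  right-hand side would be negative, so the function would be 1 almost everywhere and its deficit
  would be 0.
\<close>

section \<open>Smooth functions and test functions\<close>

lemma Ck_Suc_imp: "Ck (Suc k) \<phi> \<Longrightarrow> Ck k \<phi>"
proof (induction k arbitrary: \<phi>)
  case 0
  then show ?case
    by (auto intro!: differentiable_imp_continuous_on simp: differentiable_on_def
        intro: differentiable_at_withinI)
next
  case (Suc k)
  from Suc.prems show ?case
    using Suc.IH by (simp only: Ck.simps) blast
qed

lemma Ck_const: "Ck k (\<lambda>x. c)"
  by (induction k arbitrary: c) simp_all

lemma Ck_add: "Ck k f \<Longrightarrow> Ck k g \<Longrightarrow> Ck k (\<lambda>x. f x + g x)"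
proof (induction k arbitrary: f g)
  case (Suc k)
  have "frechet_derivative (\<lambda>x. f x + g x) (at x) b
      = frechet_derivative f (at x) b + frechet_derivative g (at x) b" for x b
    using Suc.prems by (intro fun_cong[OF frechet_derivative_at, symmetric] has_derivative_add)
      (simp_all flip: frechet_derivative_works)
  with Suc show ?case by (simp add: differentiable_add)
qed (simp add: continuous_on_add)

lemma Ck_mult: "Ck k f \<Longrightarrow> Ck k g \<Longrightarrow> Ck k (\<lambda>x. f x * g x)"
proof (induction k arbitrary: f g)
  case (Suc k)
  have "frechet_derivative (\<lambda>x. f x * g x) (at x) b
      = f x * frechet_derivative g (at x) b + frechet_derivative f (at x) b * g x" for x b
    using Suc.prems by (intro fun_cong[OF frechet_derivative_at, symmetric] has_derivative_mult)
      (simp_all flip: frechet_derivative_works)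
  with Suc.prems Suc.IH Ck_Suc_imp[of k f] Ck_Suc_imp[of k g] show ?case
    by (simp add: differentiable_mult Ck_add)
qed (simp add: continuous_on_mult)

lemma Ck_prod: "finite S \<Longrightarrow> (\<And>i. i \<in> S \<Longrightarrow> Ck k (f i)) \<Longrightarrow> Ck k (\<lambda>x. \<Prod>i\<in>S. f i x)"
  by (induction S rule: finite_induct) (simp_all add: Ck_const Ck_mult)

text \<open>
  Smooth functions of several variables come from smooth functions of one variable. A derivative
  in a fixed direction is again of this form, up to a constant, so the induction closes.
\<close>

lemma Ck_inner:
  fixes \<psi> :: "real \<Rightarrow> real"
  shows "Ck k \<psi> \<Longrightarrow> Ck k (\<lambda>x. \<psi> (x \<bullet> v + d))"
proof (induction k arbitrary: \<psi>)
  case 0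
  then show ?case
    by (auto intro!: continuous_intros continuous_on_compose2[of UNIV \<psi>])
next
  case (Suc k)
  have "((\<lambda>x. \<psi> (x \<bullet> v + d)) has_derivative
      (\<lambda>h. frechet_derivative \<psi> (at (x \<bullet> v + d)) (h \<bullet> v))) (at x)" for x
  proof (rule has_derivative_compose[where f = "\<lambda>x. x \<bullet> v + d" and f' = "\<lambda>h. h \<bullet> v" and g = \<psi>])
    show "((\<lambda>x. x \<bullet> v + d) has_derivative (\<lambda>h. h \<bullet> v)) (at x)"
      by (auto intro!: derivative_eq_intros)
    show "(\<psi> has_derivative frechet_derivative \<psi> (at (x \<bullet> v + d))) (at (x \<bullet> v + d))"
      using Suc.prems by (simp flip: frechet_derivative_works)
  qed
  note d = this
  have lin: "frechet_derivative \<psi> (at y) r = r * frechet_derivative \<psi> (at y) 1" for y r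
  proof -
    have "bounded_linear (frechet_derivative \<psi> (at y))"
      using Suc.prems by (intro has_derivative_bounded_linear[where f = \<psi> and F = "at y"])
        (simp flip: frechet_derivative_works)
    from linear_cmul[OF bounded_linear.linear[OF this], of r 1] show ?thesis by simp
  qed
  have "frechet_derivative (\<lambda>x. \<psi> (x \<bullet> v + d)) (at x) b
      = (b \<bullet> v) * frechet_derivative \<psi> (at (x \<bullet> v + d)) 1" for x b
    using fun_cong[OF frechet_derivative_at[OF d, of x], of b] lin[of "x \<bullet> v + d" "b \<bullet> v"] by simp
  moreover have "(\<lambda>x. \<psi> (x \<bullet> v + d)) differentiable at x" for x
    using d differentiable_def by blast
  ultimately show ?case
    using Suc.prems Suc.IH[of "\<lambda>y. frechet_derivative \<psi> (at y) 1"] by (simp add: Ck_mult Ck_const)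
qed

lemma line_derivative:
  assumes "\<forall>y. \<phi> differentiable (at y)"
  shows "((\<lambda>t::real. \<phi> (x + t *\<^sub>R e)) has_derivative
      (\<lambda>h. frechet_derivative \<phi> (at (x + t *\<^sub>R e)) (h *\<^sub>R e))) (at t)"
proof (rule has_derivative_compose[where f = "\<lambda>t. x + t *\<^sub>R e"])
  show "((\<lambda>t. x + t *\<^sub>R e) has_derivative (\<lambda>h. h *\<^sub>R e)) (at t)"
    by (auto intro!: derivative_eq_intros)
qed (use assms in \<open>simp flip: frechet_derivative_works\<close>)

text \<open>
  Test functions restrict to test functions on lines parallel to the axes; this is how a weak
  derivative in one variable can be used inside a function of several variables.
\<close>

lemma Ck_line:
  fixes e :: "'a::euclidean_space"
  assumes e: "e \<in> Basis"
  shows "Ck k \<phi> \<Longrightarrow> Ck k (\<lambda>t::real. \<phi> (x + t *\<^sub>R e))"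
proof (induction k arbitrary: \<phi>)
  case 0
  then show ?case
    by (auto intro!: continuous_intros continuous_on_compose2[of UNIV \<phi>])
next
  case (Suc k)
  note d = line_derivative[of \<phi> x e]
  have "frechet_derivative (\<lambda>t::real. \<phi> (x + t *\<^sub>R e)) (at t) 1
      = frechet_derivative \<phi> (at (x + t *\<^sub>R e)) e" for t
    using fun_cong[OF frechet_derivative_at[OF d, of t], of 1] Suc.prems by simp
  moreover have "(\<lambda>t. \<phi> (x + t *\<^sub>R e)) differentiable at t" for t
    using d Suc.prems by (auto simp: differentiable_def)
  ultimately show ?case
    using Suc.prems Suc.IH[of "\<lambda>y. frechet_derivative \<phi> (at y) e"] e by simp
qed

lemma has_real_derivative_imp_Ck_Suc:
  fixes \<phi> :: "real \<Rightarrow> real"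
  assumes "\<And>x. (\<phi> has_real_derivative \<phi>' x) (at x)" "Ck k \<phi>'"
  shows "Ck (Suc k) \<phi>"
proof -
  have "frechet_derivative \<phi> (at x) 1 = \<phi>' x" for x
    using fun_cong[OF frechet_derivative_at[OF assms(1)[of x, unfolded has_field_derivative_def]], of 1]
    by simp
  then show ?thesis
    using assms by (auto simp: real_differentiable_def intro: real_differentiable_def[THEN iffD2])
qed

text \<open>
  For \<open>p = 1\<close> this is the standard function \<open>exp (-1/x)\<close>, smooth and flat at 0. The polynomial
  factor makes the family closed under differentiation.
\<close>

definition flat :: "real poly \<Rightarrow> real \<Rightarrow> real" where
  "flat p x = (if x > 0 then poly p (1 / x) * exp (- (1 / x)) else 0)"

text \<open>
  With \<open>y = 1/x\<close> this is the decay of \<open>y\<^sup>i exp (-y)\<close> at infinity.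
\<close>

lemma flat_tendsto_0: "(flat p \<longlongrightarrow> 0) (at_right 0)"
proof -
  have 1: "((\<lambda>y::real. y ^ i * exp (- y)) \<longlongrightarrow> 0) at_top" for i
    using tendsto_power_div_exp_0[of i] by (simp only: exp_minus divide_inverse)
  have "((\<lambda>y. \<Sum>i\<le>degree p. coeff p i * (y ^ i * exp (- y))) \<longlongrightarrow> (\<Sum>i\<le>degree p. coeff p i * 0)) at_top"
    by (intro tendsto_sum tendsto_mult 1 tendsto_const)
  then have "((\<lambda>y. poly p y * exp (- y)) \<longlongrightarrow> 0) at_top"
    by (simp add: poly_altdef sum_distrib_right mult.assoc)
  from filterlim_compose[OF this filterlim_inverse_at_top_right]
  show ?thesis
    by (rule Lim_transform_eventually)
      (auto simp: flat_def eventually_at_right_field field_simps intro!: exI[of _ 1])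
qed

text \<open>
  At 0 the difference quotient from the right is \<open>flat (pCons 0 p)\<close>, which tends to 0.
\<close>

lemma flat_derivative:
  "(flat p has_real_derivative flat (monom 1 2 * (p - pderiv p)) x) (at x)"
proof -
  consider "x > 0" | "x < 0" | "x = 0" by linarith
  then show ?thesis
  proof cases
    case 1
    have "((\<lambda>x. poly p (1 / x) * exp (- (1 / x))) has_real_derivative
        flat (monom 1 2 * (p - pderiv p)) x) (at x)"
      using 1 by (auto intro!: derivative_eq_intros DERIV_chain2[OF poly_DERIV]
          simp: flat_def poly_monom power2_eq_square field_simps)
    then show ?thesis
      by (rule has_field_derivative_transform_within_open[where S = "{0<..}"])
        (use 1 in \<open>auto simp: flat_def\<close>)
  next
    case 2
    have "((\<lambda>x. 0) has_real_derivative flat (monom 1 2 * (p - pderiv p)) x) (at x)"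
      using 2 by (simp add: flat_def)
    then show ?thesis
      by (rule has_field_derivative_transform_within_open[where S = "{..<0}"])
        (use 2 in \<open>auto simp: flat_def\<close>)
  next
    case 3
    have "((\<lambda>h. flat p h / h) \<longlongrightarrow> 0) (at_right 0)"
      by (rule Lim_transform_eventually[OF flat_tendsto_0[of "pCons 0 p"]])
        (auto simp: flat_def eventually_at_right_field intro!: exI[of _ 1])
    moreover have "((\<lambda>h. flat p h / h) \<longlongrightarrow> 0) (at_left 0)"
      by (rule tendsto_eventually) (auto simp: flat_def eventually_at_left_field intro!: exI[of _ "-1"])
    ultimately have "((\<lambda>h. flat p h / h) \<longlongrightarrow> 0) (at 0)"
      by (simp add: filterlim_at_split)
    then show ?thesis
      using 3 by (simp add: DERIV_def flat_def)
  qed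
qed

lemma Ck_flat: "Ck k (flat p)"
proof (induction k arbitrary: p)
  case 0
  show ?case
    using flat_derivative DERIV_isCont by (fastforce intro: continuous_at_imp_continuous_on)
next
  case (Suc k)
  show ?case by (rule has_real_derivative_imp_Ck_Suc[OF flat_derivative Suc])
qed

text \<open>
  Since \<open>flat 1 (m * t)\<close> tends to 1 for \<open>t > 0\<close> and vanishes for \<open>t \<le> 0\<close>, these test
  functions converge to the indicator of the box between \<open>l\<close> and \<open>u\<close> and stay below it.
\<close>

definition bump :: "nat \<Rightarrow> 'a::euclidean_space \<Rightarrow> 'a \<Rightarrow> 'a \<Rightarrow> real" where
  "bump m l u x = (\<Prod>b\<in>Basis. flat 1 (real m * (x \<bullet> b - l \<bullet> b)) * flat 1 (real m * (u \<bullet> b - x \<bullet> b)))"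

lemma flat_1: "flat 1 x = (if x > 0 then exp (- (1 / x)) else 0)"
  by (simp add: flat_def)

lemma bump_eq_0:
  assumes "x \<notin> box l u"
  shows "bump m l u x = 0"
proof -
  obtain b where b: "b \<in> Basis" "x \<bullet> b \<le> l \<bullet> b \<or> u \<bullet> b \<le> x \<bullet> b"
    using assms by (auto simp: mem_box not_less)
  then have "real m * (x \<bullet> b - l \<bullet> b) \<le> 0 \<or> real m * (u \<bullet> b - x \<bullet> b) \<le> 0"
    by (auto intro!: mult_nonneg_nonpos)
  then show ?thesis
    unfolding bump_def using b(1) by (intro prod_zero) (auto simp: flat_1 intro!: bexI[of _ b])
qed

lemma bump_range: "0 \<le> bump m l u x" "bump m l u x \<le> 1"
proof -
  have *: "0 \<le> flat 1 y" "flat 1 y \<le> 1" for y by (auto simp: flat_1)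
  show "0 \<le> bump m l u x" unfolding bump_def by (intro prod_nonneg) (simp add: *)
  show "bump m l u x \<le> 1" unfolding bump_def
    by (intro prod_le_1 conjI mult_nonneg_nonneg mult_le_one) (simp_all add: *)
qed

lemma bump_tendsto_indicator: "(\<lambda>m. bump m l u x) \<longlonglongrightarrow> indicator (box l u) x"
proof (cases "x \<in> box l u")
  case True
  have *: "(\<lambda>m. flat 1 (real m * y)) \<longlonglongrightarrow> 1" if "y > 0" for y
  proof -
    have "(\<lambda>m. exp (- (inverse (real m) * (1 / y)))) \<longlonglongrightarrow> exp (- (0 * (1 / y)))"
      by (intro tendsto_intros lim_inverse_n)
    then have "(\<lambda>m. exp (- (inverse (real m) * (1 / y)))) \<longlonglongrightarrow> 1" by simp
    then show ?thesis
      by (rule Lim_transform_eventually)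
        (use that in \<open>auto simp: flat_1 field_simps intro!: eventually_sequentiallyI[of 1]\<close>)
  qed
  have "(\<lambda>m. bump m l u x) \<longlonglongrightarrow> (\<Prod>b\<in>(Basis::'a set). 1 * 1)"
    unfolding bump_def using True by (intro tendsto_prod tendsto_mult *) (auto simp: mem_box)
  with True show ?thesis by simp
qed (simp add: bump_eq_0)

lemma test_function_bump: "test_function (bump m l u)"
  unfolding test_function_def
proof (intro conjI allI)
  fix k
  have "flat 1 (real m * (x \<bullet> b - l \<bullet> b)) = flat 1 (x \<bullet> (real m *\<^sub>R b) + - real m * (l \<bullet> b))"
    "flat 1 (real m * (u \<bullet> b - x \<bullet> b)) = flat 1 (x \<bullet> (- real m *\<^sub>R b) + real m * (u \<bullet> b))" for x b :: 'a
    by (simp_all add: algebra_simps)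
  then show "Ck k (bump m l u)"
    unfolding bump_def[abs_def] by (simp only:) (intro Ck_prod Ck_mult Ck_inner Ck_flat finite_Basis)
  have "{x. bump m l u x \<noteq> 0} \<subseteq> cbox l u"
    using bump_eq_0 box_subset_cbox by blast
  then show "compact (closure {x. bump m l u x \<noteq> 0})"
    using bounded_cbox bounded_subset by (metis compact_closure)
qed

lemma test_function_line:
  assumes "test_function \<phi>" "e \<in> Basis"
  shows "test_function (\<lambda>t::real. \<phi> (x + t *\<^sub>R e))"
  unfolding test_function_def
proof (intro conjI allI Ck_line assms)
  show "Ck k \<phi>" for k using assms by (simp add: test_function_def)
  obtain B where B: "\<And>y. \<phi> y \<noteq> 0 \<Longrightarrow> norm y \<le> B"
    using assms unfolding test_function_def compact_closure by (auto simp: bounded_iff)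
  have "\<bar>t\<bar> \<le> B + norm x" if "\<phi> (x + t *\<^sub>R e) \<noteq> 0" for t
    using B[OF that] norm_triangle_ineq4[of "x + t *\<^sub>R e" x] assms(2) by simp
  then show "compact (closure {t. \<phi> (x + t *\<^sub>R e) \<noteq> 0})"
    by (auto simp: bounded_iff intro!: exI[of _ "B + norm x"])
qed

section \<open>Uniqueness of weak gradients\<close>

lemma locally_integrable_mult_continuous:
  fixes g \<psi> :: "'a::euclidean_space \<Rightarrow> real"
  assumes g: "locally_integrable g" and \<psi>: "continuous_on UNIV \<psi>"
  shows "locally_integrable (\<lambda>x. g x * \<psi> x)"
  unfolding locally_integrable_def set_integrable_def
proof (intro conjI allI impI)
  have \<psi>m[measurable]: "\<psi> \<in> borel_measurable borel"
    using \<psi> by (rule borel_measurable_continuous_onI)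
  have gm[measurable]: "g \<in> borel_measurable borel"
    using g by (simp add: locally_integrable_def)
  show "(\<lambda>x. g x * \<psi> x) \<in> borel_measurable borel" by measurable
  fix K :: "'a set" assume K: "compact K"
  then have [measurable]: "K \<in> sets borel" by (simp add: borel_compact)
  have "compact (\<psi> ` K)"
    using K \<psi> by (intro compact_continuous_image) (auto intro: continuous_on_subset)
  then obtain C where "\<And>x. x \<in> K \<Longrightarrow> norm (\<psi> x) \<le> C"
    using compact_imp_bounded by (fastforce simp: bounded_iff)
  then have C: "\<bar>\<psi> x\<bar> \<le> \<bar>C\<bar>" if "x \<in> K" for x
    using that by fastforce
  have "integrable lborel (\<lambda>x. \<bar>C\<bar> * (indicator K x *\<^sub>R g x))"
    using g K by (simp add: locally_integrable_def set_integrable_def)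
  then show "integrable lborel (\<lambda>x. indicator K x *\<^sub>R (g x * \<psi> x))"
  proof (rule Bochner_Integration.integrable_bound)
    show "AE x in lborel. norm (indicator K x *\<^sub>R (g x * \<psi> x)) \<le> norm (\<bar>C\<bar> * (indicator K x *\<^sub>R g x))"
      using C by (intro AE_I2) (auto simp: indicator_def abs_mult mult.commute intro!: mult_right_mono)
  qed measurable
qed

lemma continuous_imp_locally_integrable:
  fixes g :: "'a::euclidean_space \<Rightarrow> real"
  assumes "continuous_on UNIV g"
  shows "locally_integrable g"
  unfolding locally_integrable_def set_integrable_def
  using assms by (auto simp del: real_scaleR_def
      intro!: borel_measurable_continuous_onI borel_integrable_compact intro: continuous_on_subset)

lemma locally_integrable_vanishing_outside:
  fixes g :: "'a::euclidean_space \<Rightarrow> real"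
  assumes "locally_integrable g" "compact K" "\<And>x. x \<notin> K \<Longrightarrow> g x = 0"
  shows "integrable lborel g"
proof -
  have "(\<lambda>x. indicator K x *\<^sub>R g x) = g" using assms(3) by (auto simp: fun_eq_iff split: split_indicator)
  with assms show ?thesis by (auto simp: locally_integrable_def set_integrable_def)
qed

lemma test_function_supp:
  assumes "test_function \<phi>"
  obtains K where "compact K" "\<And>x. x \<notin> K \<Longrightarrow> \<phi> x = 0"
    "\<And>x b. x \<notin> K \<Longrightarrow> frechet_derivative \<phi> (at x) b = 0"
proof
  let ?K = "closure {x. \<phi> x \<noteq> 0}"
  show "compact ?K" using assms by (simp add: test_function_def)
  show *: "\<phi> x = 0" if "x \<notin> ?K" for x using that by (auto simp: closure_def)
  show "frechet_derivative \<phi> (at x) b = 0" if "x \<notin> ?K" for x b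
  proof -
    have "((\<lambda>x. 0::real) has_derivative (\<lambda>h. 0)) (at x)" by simp
    then have "(\<phi> has_derivative (\<lambda>h. 0)) (at x)"
      by (rule has_derivative_transform_within_open[where s = "- ?K"]) (simp_all only: that * Compl_iff open_Compl closed_closure not_False_eq_True)
    from fun_cong[OF frechet_derivative_at[OF this], of b] show ?thesis by simp
  qed
qed

lemma test_function_continuous:
  assumes "test_function \<phi>"
  shows "continuous_on UNIV \<phi>" "b \<in> Basis \<Longrightarrow> continuous_on UNIV (\<lambda>x. frechet_derivative \<phi> (at x) b)"
proof -
  have "Ck 0 \<phi>" "Ck (Suc 0) \<phi>" using assms unfolding test_function_def by blast+
  then show "continuous_on UNIV \<phi>" "b \<in> Basis \<Longrightarrow> continuous_on UNIV (\<lambda>x. frechet_derivative \<phi> (at x) b)"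
    by simp_all
qed

lemma integrable_times_test_function:
  fixes g :: "'a::euclidean_space \<Rightarrow> real"
  assumes g: "locally_integrable g" and \<phi>: "test_function \<phi>"
  shows "integrable lborel (\<lambda>x. g x * \<phi> x)"
    "b \<in> Basis \<Longrightarrow> integrable lborel (\<lambda>x. g x * frechet_derivative \<phi> (at x) b)"
proof -
  obtain K where K: "compact K" "\<And>x. x \<notin> K \<Longrightarrow> \<phi> x = 0"
    "\<And>x b. x \<notin> K \<Longrightarrow> frechet_derivative \<phi> (at x) b = 0"
    using \<phi> by (rule test_function_supp) blast
  show "integrable lborel (\<lambda>x. g x * \<phi> x)"
    by (rule locally_integrable_vanishing_outside[OF locally_integrable_mult_continuous[OF g
        test_function_continuous(1)[OF \<phi>]] K(1)]) (simp add: K)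
  show "b \<in> Basis \<Longrightarrow> integrable lborel (\<lambda>x. g x * frechet_derivative \<phi> (at x) b)"
    by (rule locally_integrable_vanishing_outside[OF locally_integrable_mult_continuous[OF g
        test_function_continuous(2)[OF \<phi>]] K(1)]) (simp_all add: K)
qed

lemma locally_integrable_inner:
  "locally_integrable G \<Longrightarrow> locally_integrable (\<lambda>x. G x \<bullet> b)"
  unfolding locally_integrable_def set_integrable_def
  by (auto simp flip: inner_scaleR_left)

lemma locally_integrable_diff:
  "locally_integrable f \<Longrightarrow> locally_integrable g \<Longrightarrow> locally_integrable (\<lambda>x. f x - g x)"
  by (auto simp: locally_integrable_def intro: set_integral_diff)

lemma locally_integrable_add:
  "locally_integrable f \<Longrightarrow> locally_integrable g \<Longrightarrow> locally_integrable (\<lambda>x. f x + g x)"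
  by (auto simp: locally_integrable_def intro: set_integral_add)

text \<open>
  Testing with bumps and passing to the limit shows that \<open>g\<close> has integral 0 over every box.
  Hence the positive and the negative part of \<open>g\<close> are densities of two measures that agree on all
  boxes. Boxes generate the Borel sets, so the measures and then their densities agree.
\<close>

lemma fundamental_lemma:
  fixes g :: "'a::euclidean_space \<Rightarrow> real"
  assumes g: "locally_integrable g" and 0: "\<And>\<phi>. test_function \<phi> \<Longrightarrow> (\<integral>x. g x * \<phi> x \<partial>lborel) = 0"
  shows "AE x in lborel. g x = 0"
proof -
  have gm[measurable]: "g \<in> borel_measurable borel"
    using g by (simp add: locally_integrable_def)
  have box_int: "integrable lborel (\<lambda>x. g x * indicator (box l u) x)" for l u
    by (rule Bochner_Integration.integrable_bound[where f = "\<lambda>x. indicator (cbox l u) x *\<^sub>R g x"])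
      (use g box_subset_cbox[of l u] in \<open>auto simp: locally_integrable_def set_integrable_def indicator_def\<close>)
  have box_0: "(\<integral>x. g x * indicator (box l u) x \<partial>lborel) = 0" for l u
  proof -
    have "(\<lambda>m. \<integral>x. g x * bump m l u x \<partial>lborel) \<longlonglongrightarrow> (\<integral>x. g x * indicator (box l u) x \<partial>lborel)"
    proof (rule integral_dominated_convergence[where w = "\<lambda>x. norm (g x * indicator (box l u) x)"])
      show "(\<lambda>x. g x * bump m l u x) \<in> borel_measurable lborel" for m
        using integrable_times_test_function(1)[OF g test_function_bump] by blast
      show "AE x in lborel. (\<lambda>m. g x * bump m l u x) \<longlonglongrightarrow> g x * indicator (box l u) x"
        by (intro AE_I2 tendsto_mult tendsto_const bump_tendsto_indicator)
      show "AE x in lborel. norm (g x * bump m l u x) \<le> norm (g x * indicator (box l u) x)" for m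
        using bump_range[of m l u] bump_eq_0[of _ l u m]
        by (intro AE_I2) (auto simp: indicator_def abs_mult intro!: mult_left_le)
    qed (use box_int in auto)
    moreover have "(\<integral>x. g x * bump m l u x \<partial>lborel) = 0" for m
      by (intro 0 test_function_bump)
    ultimately show ?thesis
      by (simp add: LIMSEQ_const_iff)
  qed
  let ?P = "\<lambda>x. max (g x) 0" and ?N = "\<lambda>x. max (- g x) 0"
  have em: "emeasure (density lborel (\<lambda>x. ennreal (p x))) (box l u)
      = ennreal (\<integral>x. p x * indicator (box l u) x \<partial>lborel)" "integrable lborel (\<lambda>x. p x * indicator (box l u) x)"
    if p: "p = ?P \<or> p = ?N" for p l u
  proof -
    have [measurable]: "p \<in> borel_measurable borel" using p by auto
    show i: "integrable lborel (\<lambda>x. p x * indicator (box l u) x)"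
      by (rule Bochner_Integration.integrable_bound[OF box_int[of l u]]) (use p in \<open>auto simp: indicator_def\<close>)
    show "emeasure (density lborel (\<lambda>x. ennreal (p x))) (box l u)
      = ennreal (\<integral>x. p x * indicator (box l u) x \<partial>lborel)"
      using p i by (auto simp: emeasure_density nn_integral_eq_integral[symmetric] ennreal_mult ennreal_indicator
          simp del: ennreal_max_0)
  qed
  have eq: "(\<integral>x. ?P x * indicator (box l u) x \<partial>lborel) = (\<integral>x. ?N x * indicator (box l u) x \<partial>lborel)" for l u
  proof -
    have "(\<integral>x. ?P x * indicator (box l u) x \<partial>lborel) - (\<integral>x. ?N x * indicator (box l u) x \<partial>lborel)
      = (\<integral>x. g x * indicator (box l u) x \<partial>lborel)"
      by (subst Bochner_Integration.integral_diff[OF em(2)[of ?P l u] em(2)[of ?N l u], symmetric])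
        (auto intro!: Bochner_Integration.integral_cong split: split_indicator)
    with box_0 show ?thesis by simp
  qed
  let ?E = "range (\<lambda>(a, b). box a b :: 'a set)"
  have "density lborel (\<lambda>x. ennreal (?P x)) = density lborel (\<lambda>x. ennreal (?N x))"
  proof (rule measure_eqI_generator_eq[of ?E UNIV _ _ "\<lambda>n. box (- real n *\<^sub>R One) (real n *\<^sub>R One)"])
    show "Int_stable ?E" by (auto simp: Int_stable_def box_Int_box)
    show "sets (density lborel (\<lambda>x. ennreal (?P x))) = sigma_sets UNIV ?E"
      "sets (density lborel (\<lambda>x. ennreal (?N x))) = sigma_sets UNIV ?E"
      by (simp_all add: borel_eq_box)
    show "(\<Union>n. box (- real n *\<^sub>R One) (real n *\<^sub>R One)) = (UNIV::'a set)"
      using UN_box_eq_UNIV by simp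
    show "emeasure (density lborel (\<lambda>x. ennreal (?P x))) X = emeasure (density lborel (\<lambda>x. ennreal (?N x))) X"
      if "X \<in> ?E" for X
      using that em(1)[of ?P] em(1)[of ?N] eq by auto
    show "emeasure (density lborel (\<lambda>x. ennreal (?P x))) (box (- real n *\<^sub>R One) (real n *\<^sub>R One)) \<noteq> \<infinity>" for n
      using em(1)[of ?P] by simp
  qed auto
  then have "AE x in lborel. ennreal (?P x) = ennreal (?N x)"
    by (subst (asm) sigma_finite_measure.density_unique_iff[OF sigma_finite_lborel]) simp_all
  then show ?thesis
    by eventually_elim (simp add: max_def split: if_splits)
qed

lemma has_weak_gradient_unique:
  assumes "has_weak_gradient g G" "has_weak_gradient g H"
  shows "AE x in lborel. G x = H x"
proof -
  have "AE x in lborel. \<forall>b\<in>Basis. G x \<bullet> b - H x \<bullet> b = 0"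
  proof (subst AE_finite_all, simp, intro ballI fundamental_lemma)
    fix b :: 'a assume b: "b \<in> Basis"
    have l: "locally_integrable (\<lambda>x. G x \<bullet> b)" "locally_integrable (\<lambda>x. H x \<bullet> b)"
      using assms by (auto simp: has_weak_gradient_def intro: locally_integrable_inner)
    then show "locally_integrable (\<lambda>x. G x \<bullet> b - H x \<bullet> b)"
      by (rule locally_integrable_diff)
    fix \<phi> :: "'a \<Rightarrow> real" assume t: "test_function \<phi>"
    have "(\<integral>x. (G x \<bullet> b) * \<phi> x \<partial>lborel) = (\<integral>x. (H x \<bullet> b) * \<phi> x \<partial>lborel)"
      using assms[unfolded has_weak_gradient_def, THEN conjunct2, THEN conjunct2, rule_format, OF t b]
      by simp
    then show "(\<integral>x. (G x \<bullet> b - H x \<bullet> b) * \<phi> x \<partial>lborel) = 0"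
      using l t by (simp add: left_diff_distrib integrable_times_test_function)
  qed
  then show ?thesis
    by eventually_elim (auto intro: euclidean_eqI)
qed

text \<open>
  Weak gradients only see classes modulo null sets. This allows the passage from a weakly
  differentiable function on the line to its continuous representative and back.
\<close>

lemma has_weak_gradient_AE_eq:
  assumes "has_weak_gradient g G" "AE x in lborel. g x = g' x" "AE x in lborel. G x = G' x"
    "g' \<in> borel_measurable borel" "G' \<in> borel_measurable borel"
  shows "has_weak_gradient g' G'"
proof -
  have l: "locally_integrable h'" if "locally_integrable h" "AE x in lborel. h x = h' x" "h' \<in> borel_measurable borel"
    for h h' :: "'a \<Rightarrow> 'c::euclidean_space"
    unfolding locally_integrable_def set_integrable_def
  proof (intro conjI allI impI that)
    fix K :: "'a set" assume K: "compact K"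
    then have [measurable]: "K \<in> sets borel" by (simp add: borel_compact)
    have m: "h \<in> borel_measurable borel" "integrable lborel (\<lambda>x. indicator K x *\<^sub>R h x)"
      using that K by (auto simp: locally_integrable_def set_integrable_def)
    note [measurable] = m(1) that(3)
    show "integrable lborel (\<lambda>x. indicator K x *\<^sub>R h' x)"
      by (rule integrable_cong_AE_imp[OF m(2)]) (measurable, use that(2) in \<open>eventually_elim, simp\<close>)
  qed
  have [measurable]: "g \<in> borel_measurable borel" "G \<in> borel_measurable borel"
    "g' \<in> borel_measurable borel" "G' \<in> borel_measurable borel"
    using assms by (auto simp: has_weak_gradient_def locally_integrable_def)
  show ?thesis
    unfolding has_weak_gradient_def
  proof (intro conjI allI impI ballI)
    show "locally_integrable g'" "locally_integrable G'"
      using assms l[OF _ assms(2)] l[OF _ assms(3)] unfolding has_weak_gradient_def by blast+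
    fix \<phi> :: "'a \<Rightarrow> real" and b :: 'a assume t: "test_function \<phi>" and b: "b \<in> Basis"
    note [measurable] = borel_measurable_continuous_onI[OF test_function_continuous(1)[OF t]]
      borel_measurable_continuous_onI[OF test_function_continuous(2)[OF t b]]
    have "(\<integral>x. g' x * frechet_derivative \<phi> (at x) b \<partial>lborel) = (\<integral>x. g x * frechet_derivative \<phi> (at x) b \<partial>lborel)"
      by (rule integral_cong_AE) (measurable, use assms(2) in \<open>eventually_elim, simp\<close>)
    also have "\<dots> = - (\<integral>x. (G x \<bullet> b) * \<phi> x \<partial>lborel)"
      using assms(1) t b by (simp add: has_weak_gradient_def)
    also have "(\<integral>x. (G x \<bullet> b) * \<phi> x \<partial>lborel) = (\<integral>x. (G' x \<bullet> b) * \<phi> x \<partial>lborel)"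
      by (rule integral_cong_AE) (measurable, use assms(3) in \<open>eventually_elim, simp\<close>)
    finally show "(\<integral>x. g' x * frechet_derivative \<phi> (at x) b \<partial>lborel) = - (\<integral>x. (G' x \<bullet> b) * \<phi> x \<partial>lborel)" .
  qed
qed

lemma has_weak_gradient_diff:
  assumes "has_weak_gradient g G" "has_weak_gradient h H"
  shows "has_weak_gradient (\<lambda>x. g x - h x) (\<lambda>x. G x - H x)"
proof -
  have l: "locally_integrable g" "locally_integrable G" "locally_integrable h" "locally_integrable H"
    using assms by (auto simp: has_weak_gradient_def)
  with assms show ?thesis
    unfolding has_weak_gradient_def
    by (auto intro!: locally_integrable_diff
        simp: left_diff_distrib inner_diff_left integrable_times_test_function locally_integrable_inner)
qed

lemma has_weak_gradient_weak_gradient: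
  "has_weak_gradient g G \<Longrightarrow> has_weak_gradient g (weak_gradient g)"
  unfolding weak_gradient_def by (rule someI[where P = "has_weak_gradient g"])

text \<open>
  Inside an integral the chosen gradient may be replaced by an explicit one.
\<close>

lemma weak_gradient_AE_eq:
  assumes "has_weak_gradient g G"
  shows "AE x in lborel. weak_gradient g x = G x"
  by (rule has_weak_gradient_unique[OF has_weak_gradient_weak_gradient[OF assms] assms])

section \<open>Weak derivatives on the line are indefinite integrals\<close>

text \<open>
  The weakly differentiable functions on the line are, up to null sets, the indefinite integrals
  of locally integrable functions. For the latter one can calculate pointwise.
\<close>

definition primitive :: "(real \<Rightarrow> real) \<Rightarrow> (real \<Rightarrow> real) \<Rightarrow> bool" where
  "primitive g G \<longleftrightarrow> locally_integrable G \<and> (\<forall>a b. a \<le> b \<longrightarrow> g b - g a = (LBINT x:{a..b}. G x))"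

lemma locally_integrable_interval:
  "locally_integrable (G :: real \<Rightarrow> real) \<Longrightarrow> set_integrable lborel {a..b} G"
  by (simp add: locally_integrable_def compact_Icc)

lemma primitive_continuous:
  assumes "primitive g G"
  shows "continuous_on UNIV g"
proof (intro continuous_at_imp_continuous_on ballI)
  fix x :: real
  have G: "set_integrable lborel {x - 1..x + 1} G"
    using assms by (auto simp: primitive_def locally_integrable_interval)
  have eq: "g y = g (x - 1) + integral {x - 1..y} G" if "y \<in> {x - 1..x + 1}" for y
  proof -
    have "g y - g (x - 1) = (LBINT x:{x-1..y}. G x)"
      using assms that by (auto simp: primitive_def)
    also have "\<dots> = integral {x - 1..y} G"
      using assms by (intro set_borel_integral_eq_integral(2) locally_integrable_interval) (simp add: primitive_def)
    finally show ?thesis by simp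
  qed
  have "continuous_on {x - 1..x + 1} (\<lambda>y. g (x - 1) + integral {x - 1..y} G)"
    using G by (intro continuous_intros indefinite_integral_continuous_1 set_borel_integral_eq_integral(1))
  then have "continuous_on {x - 1..x + 1} g"
    by (rule continuous_on_eq) (rule eq[symmetric])
  then have "continuous_on {x - 1<..<x + 1} g"
    by (rule continuous_on_subset) auto
  then show "isCont g x"
    by (simp add: continuous_on_eq_continuous_at)
qed

text \<open>
  Fubini on the triangle \<open>a \<le> t \<le> s \<le> b\<close>: integrating \<open>G s * H t\<close> first in \<open>t\<close> gives
  \<open>G s * (h s - h a)\<close>, integrating it first in \<open>s\<close> gives \<open>H t * (g b - g t)\<close>.
\<close>

lemma integration_by_parts:
  assumes g: "primitive g G" and h: "primitive h H" and ab: "a \<le> b"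
  shows "(LBINT x:{a..b}. G x * h x) + (LBINT x:{a..b}. g x * H x) = g b * h b - g a * h a"
proof -
  have [measurable]: "g \<in> borel_measurable borel" "h \<in> borel_measurable borel"
    using g h by (auto intro!: borel_measurable_continuous_onI primitive_continuous)
  have [measurable]: "G \<in> borel_measurable borel" "H \<in> borel_measurable borel"
    and li: "locally_integrable G" "locally_integrable H"
    using g h by (auto simp: primitive_def locally_integrable_def)
  have int: "set_integrable lborel {a..b} (\<lambda>x. G x * h x)" "set_integrable lborel {a..b} (\<lambda>x. H x * g x)"
    "set_integrable lborel {c..d} G" "set_integrable lborel {c..d} H" for c d
    using li g h by (auto intro!: locally_integrable_interval locally_integrable_mult_continuous primitive_continuous)
  define f where "f s t = (indicator {a..b} s * G s) * (indicator {a..b} t * H t) * (if t \<le> s then 1 else 0)" for s t :: real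
  have i1: "integrable lborel (\<lambda>s. indicator {a..b} s * G s)" "integrable lborel (\<lambda>s. indicator {a..b} s * H s)"
    using int(3,4)[of a b] by (simp_all add: set_integrable_def)
  have fi: "integrable lborel (\<lambda>t. f s t)" for s
    unfolding f_def mult.assoc
    by (intro integrable_mult_right Bochner_Integration.integrable_bound[OF i1(2)]) auto
  have [measurable]: "case_prod f \<in> borel_measurable (lborel \<Otimes>\<^sub>M lborel)"
    unfolding f_def by measurable
  have "integrable (lborel \<Otimes>\<^sub>M lborel) (case_prod f)"
  proof (rule lborel_pair.Fubini_integrable)
    show "AE x in lborel. integrable lborel (\<lambda>y. case (x, y) of (x, xa) \<Rightarrow> f x xa)"
      using fi by simp
    have "norm (\<integral>y. norm (f s y) \<partial>lborel) \<le> \<bar>indicator {a..b} s * G s\<bar> * (\<integral>t. \<bar>indicator {a..b} t * H t\<bar> \<partial>lborel)" for s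
    proof -
      have "norm (\<integral>y. norm (f s y) \<partial>lborel) = (\<integral>y. norm (f s y) \<partial>lborel)"
        by simp
      also have "\<dots> \<le> (\<integral>t. \<bar>indicator {a..b} s * G s\<bar> * \<bar>indicator {a..b} t * H t\<bar> \<partial>lborel)"
        by (intro integral_mono integrable_norm fi integrable_mult_right integrable_abs i1)
          (auto simp: f_def abs_mult)
      finally show ?thesis by simp
    qed
    then show "integrable lborel (\<lambda>x. \<integral>y. norm (case (x, y) of (x, xa) \<Rightarrow> f x xa) \<partial>lborel)"
      by (intro Bochner_Integration.integrable_bound[OF integrable_mult_left[OF integrable_abs[OF i1(1)],
            of "\<integral>t. \<bar>indicator {a..b} t * H t\<bar> \<partial>lborel"]])
        (auto simp: abs_mult)
  qed measurable
  then have "(\<integral>t. (\<integral>s. f s t \<partial>lborel) \<partial>lborel) = (\<integral>s. (\<integral>t. f s t \<partial>lborel) \<partial>lborel)"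
    by (rule lborel_pair.Fubini_integral)
  moreover have "(\<integral>t. f s t \<partial>lborel) = indicator {a..b} s * G s * (h s - h a)" for s
  proof (cases "s \<in> {a..b}")
    case True
    then have "f s t = G s * (indicator {a..s} t *\<^sub>R H t)" for t
      by (auto simp: f_def indicator_def)
    then have "(\<integral>t. f s t \<partial>lborel) = G s * (LBINT x:{a..s}. H x)"
      by (simp add: set_lebesgue_integral_def)
    with h True show ?thesis by (simp add: primitive_def)
  qed (simp add: f_def)
  moreover have "(\<integral>s. f s t \<partial>lborel) = indicator {a..b} t * H t * (g b - g t)" for t
  proof (cases "t \<in> {a..b}")
    case True
    then have "f s t = H t * (indicator {t..b} s *\<^sub>R G s)" for s
      by (auto simp: f_def indicator_def)
    then have "(\<integral>s. f s t \<partial>lborel) = H t * (LBINT x:{t..b}. G x)"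
      by (simp add: set_lebesgue_integral_def)
    with g True show ?thesis by (simp add: primitive_def)
  qed (simp add: f_def)
  ultimately have "(LBINT t:{a..b}. H t * (g b - g t)) = (LBINT s:{a..b}. G s * (h s - h a))"
    by (simp add: set_lebesgue_integral_def mult.assoc)
  then have "(LBINT x:{a..b}. H x * g b) - (LBINT x:{a..b}. H x * g x) =
      (LBINT x:{a..b}. G x * h x) - (LBINT x:{a..b}. G x * h a)"
    using int by (simp add: right_diff_distrib set_integral_diff)
  then have "(h b - h a) * g b - (LBINT x:{a..b}. H x * g x) =
      (LBINT x:{a..b}. G x * h x) - (g b - g a) * h a"
    using g h ab by (simp add: primitive_def)
  then show ?thesis
    by (simp add: algebra_simps)
qed

lemma primitive_mult:
  assumes g: "primitive g G" and h: "primitive h H"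
  shows "primitive (\<lambda>x. g x * h x) (\<lambda>x. G x * h x + g x * H x)"
proof -
  have li: "locally_integrable (\<lambda>x. G x * h x)" "locally_integrable (\<lambda>x. H x * g x)"
    using g h by (auto intro!: locally_integrable_mult_continuous primitive_continuous simp: primitive_def)
  then have "locally_integrable (\<lambda>x. g x * H x)" by (simp add: mult.commute)
  with li integration_by_parts[OF g h] show ?thesis
    unfolding primitive_def by (auto intro!: locally_integrable_add simp: set_integral_add locally_integrable_interval)
qed

lemma primitive_C1:
  assumes "\<And>x. (g has_real_derivative G x) (at x)" "continuous_on UNIV G"
  shows "primitive g G"
  unfolding primitive_def
proof (intro conjI allI impI)
  show "locally_integrable G" using assms by (simp add: continuous_imp_locally_integrable)
  fix a b :: real assume "a \<le> b"
  then show "g b - g a = (LBINT x:{a..b}. G x)"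
    unfolding set_lebesgue_integral_def
    by (intro integral_FTC_atLeastAtMost[symmetric])
      (auto intro: assms continuous_on_subset has_field_derivative_at_within
        simp flip: has_real_derivative_iff_has_vector_derivative)
qed

lemma test_function_primitive:
  assumes "test_function \<phi>"
  shows "primitive \<phi> (\<lambda>x. frechet_derivative \<phi> (at x) 1)"
proof (rule primitive_C1)
  have "Ck 1 \<phi>" using assms by (simp add: test_function_def)
  then have "\<phi> differentiable (at x)" for x by simp
  then obtain D where D: "(\<phi> has_real_derivative D x) (at x)" for x
    unfolding real_differentiable_def by metis
  then have "frechet_derivative \<phi> (at x) 1 = D x" for x
    using fun_cong[OF frechet_derivative_at[OF D[of x, unfolded has_field_derivative_def]], of 1] by simp
  with D show "(\<phi> has_real_derivative frechet_derivative \<phi> (at x) 1) (at x)" for x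
    by simp
  show "continuous_on UNIV (\<lambda>x. frechet_derivative \<phi> (at x) 1)"
    using assms by (simp add: test_function_continuous)
qed

lemma LBINT_eq_integral:
  fixes f :: "'a::euclidean_space \<Rightarrow> real"
  assumes "\<And>x. x \<notin> A \<Longrightarrow> f x = 0"
  shows "(LBINT x:A. f x) = (\<integral>x. f x \<partial>lborel)"
  unfolding set_lebesgue_integral_def
  by (intro Bochner_Integration.integral_cong) (auto split: split_indicator intro: assms)

lemma compact_subset_symmetric_interval:
  fixes K :: "real set"
  assumes "compact K"
  obtains R where "K \<subseteq> {-R<..<R}" "R > 0"
proof -
  obtain B where "B > 0" "\<And>x. x \<in> K \<Longrightarrow> norm x \<le> B"
    using compact_imp_bounded[OF assms] bounded_pos by metis
  then show thesis by (intro that[of "B + 1"]) (fastforce simp: abs_le_iff)+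
qed

text \<open>
  Integration by parts on an interval that contains the support of the test function in its
  interior; the boundary terms vanish.
\<close>

lemma primitive_imp_weak_gradient:
  assumes g: "primitive g G"
  shows "has_weak_gradient g G"
  unfolding has_weak_gradient_def
proof (intro conjI allI impI ballI)
  show "locally_integrable g"
    by (intro continuous_imp_locally_integrable primitive_continuous[OF g])
  show "locally_integrable G" using g by (simp add: primitive_def)
  fix \<phi> :: "real \<Rightarrow> real" and b :: real
  assume \<phi>: "test_function \<phi>" and "b \<in> Basis"
  then have b: "b = 1" by simp
  let ?d = "\<lambda>x. frechet_derivative \<phi> (at x) 1"
  obtain K where K: "compact K" "\<And>x. x \<notin> K \<Longrightarrow> \<phi> x = 0" "\<And>x b. x \<notin> K \<Longrightarrow> frechet_derivative \<phi> (at x) b = 0"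
    using \<phi> by (rule test_function_supp) blast
  obtain R where R: "K \<subseteq> {-R<..<R}" "R > 0"
    using K(1) by (rule compact_subset_symmetric_interval)
  have "(LBINT x:{-R..R}. G x * \<phi> x) + (LBINT x:{-R..R}. g x * ?d x) = g R * \<phi> R - g (-R) * \<phi> (-R)"
    using R by (intro integration_by_parts g test_function_primitive \<phi>) simp
  also have "\<dots> = 0"
  proof -
    have "R \<notin> K" "-R \<notin> K" using R by auto
    then show ?thesis using K(2) by simp
  qed
  finally have 0: "(LBINT x:{-R..R}. G x * \<phi> x) + (LBINT x:{-R..R}. g x * ?d x) = 0" .
  have out: "x \<notin> K" if "x \<notin> {-R..R}" for x
    using R that by force
  have 1: "(LBINT x:{-R..R}. G x * \<phi> x) = (\<integral>x. G x * \<phi> x \<partial>lborel)"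
    using out by (intro LBINT_eq_integral) (simp add: K)
  have 2: "(LBINT x:{-R..R}. g x * ?d x) = (\<integral>x. g x * ?d x \<partial>lborel)"
    using out by (intro LBINT_eq_integral) (simp add: K)
  from 0 show "(\<integral>x. g x * frechet_derivative \<phi> (at x) b \<partial>lborel) = - (\<integral>x. G x \<bullet> b * \<phi> x \<partial>lborel)"
    unfolding 1 2 by (simp add: b)
qed

lemma ex_primitive:
  assumes G: "locally_integrable (G :: real \<Rightarrow> real)"
  shows "\<exists>g. primitive g G"
proof
  show "primitive (\<lambda>x. LBINT t=0..x. G t) G"
    unfolding primitive_def
  proof (intro conjI allI impI G)
    fix a b :: real assume ab: "a \<le> b"
    have "interval_lebesgue_integrable lborel (ereal c) (ereal d) G" if "c \<le> d" for c d :: real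
      unfolding interval_lebesgue_integrable_def using that
      by (auto intro!: set_integrable_subset[OF locally_integrable_interval[OF G, of c d]])
    from this[of "min 0 (min a b)" "max 0 (max a b)"]
    have "(LBINT t=0..a. G t) + (LBINT t=a..b. G t) = (LBINT t=0..b. G t)"
      by (intro interval_integral_sum) (auto simp: min_def max_def zero_ereal_def split: if_splits)
    with ab show "(LBINT t=0..b. G t) - (LBINT t=0..a. G t) = (LBINT x:{a..b}. G x)"
      by (simp add: interval_integral_Icc)
  qed
qed

lemma Ck_all_antiderivative:
  fixes \<phi> :: "real \<Rightarrow> real"
  assumes "\<And>x. (\<phi> has_real_derivative \<phi>' x) (at x)" "\<And>k. Ck k \<phi>'"
  shows "Ck k \<phi>"
  using has_real_derivative_imp_Ck_Suc[OF assms(1) assms(2)] Ck_Suc_imp by blast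

text \<open>
  The indefinite integral of \<open>\<theta>\<close> vanishes to the left of the support of \<open>\<theta>\<close>, and to the right
  of it because the total integral is 0.
\<close>

lemma test_function_antiderivative:
  fixes \<theta> :: "real \<Rightarrow> real"
  assumes \<theta>: "test_function \<theta>" and 0: "(\<integral>x. \<theta> x \<partial>lborel) = 0"
  obtains \<phi> where "test_function \<phi>" "\<And>x. frechet_derivative \<phi> (at x) 1 = \<theta> x"
proof -
  obtain K where K: "compact K" "\<And>x. x \<notin> K \<Longrightarrow> \<theta> x = 0"
    using \<theta> by (rule test_function_supp) blast
  obtain R where R: "K \<subseteq> {-R<..<R}" "R > 0"
    using K(1) by (rule compact_subset_symmetric_interval)
  have \<theta>0: "\<theta> x = 0" if "x \<le> - R \<or> R \<le> x" for x
  proof -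
    have "x \<notin> K" using that R by force
    then show ?thesis by (rule K)
  qed
  have c: "continuous_on S \<theta>" for S
    using test_function_continuous(1)[OF \<theta>] continuous_on_subset by blast
  \<comment> \<open>Starting one unit left of \<open>-R\<close> puts every point \<open>x \<ge> -R\<close> in the interior of an interval of
    integration; to the left of the starting point the integral is over the empty set.\<close>
  define \<phi> where "\<phi> x = integral {-R - 1..x} \<theta>" for x
  have left: "\<phi> x = 0" if "x \<le> - R" for x
  proof -
    have "\<phi> x = integral {-R - 1..x} (\<lambda>_. 0)"
      unfolding \<phi>_def using that by (intro Henstock_Kurzweil_Integration.integral_cong \<theta>0) auto
    then show ?thesis by simp
  qed
  have right: "\<phi> x = 0" if "R \<le> x" for x
  proof -
    have "\<phi> x = (LBINT t:{-R - 1..x}. \<theta> t)"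
      unfolding \<phi>_def by (intro set_borel_integral_eq_integral(2)[symmetric] borel_integrable_atLeastAtMost' c)
    also have "\<dots> = (\<integral>x. \<theta> x \<partial>lborel)"
      using that by (intro LBINT_eq_integral \<theta>0) auto
    finally show ?thesis using 0 by simp
  qed
  have d: "(\<phi> has_real_derivative \<theta> x) (at x)" for x
  proof (cases "x < - R")
    case True
    have "((\<lambda>x. 0) has_real_derivative \<theta> x) (at x)" using True \<theta>0[of x] by simp
    then show ?thesis
      by (rule has_field_derivative_transform_within_open[where S = "{..<-R}"]) (use True left in auto)
  next
    case False
    have "(\<phi> has_real_derivative \<theta> x) (at x within {-R - 1..x + 1})"
      unfolding \<phi>_def[abs_def] using False by (intro integral_has_real_derivative c) auto
    then show ?thesis
      using False at_within_interior[of x "{-R - 1..x + 1}"] by (simp add: interior_atLeastAtMost_real)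
  qed
  show thesis
  proof (rule that)
    have "{x. \<phi> x \<noteq> 0} \<subseteq> {-R..R}"
    proof
      fix x assume "x \<in> {x. \<phi> x \<noteq> 0}"
      then have "\<not> x \<le> - R" "\<not> R \<le> x" using left right by blast+
      then show "x \<in> {-R..R}" by simp
    qed
    then have "bounded {x. \<phi> x \<noteq> 0}"
      using bounded_closed_interval bounded_subset by blast
    then show "test_function \<phi>"
      using \<theta> by (auto simp: test_function_def compact_closure intro: Ck_all_antiderivative[OF d])
    show "frechet_derivative \<phi> (at x) 1 = \<theta> x" for x
      using fun_cong[OF frechet_derivative_at[OF d[of x, unfolded has_field_derivative_def]], of 1] by simp
  qed
qed

lemma test_function_add_cmult:
  assumes "test_function \<psi>" "test_function \<theta>"
  shows "test_function (\<lambda>x. \<psi> x + c * \<theta> x)"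
proof -
  have "bounded ({x. \<psi> x \<noteq> 0} \<union> {x. \<theta> x \<noteq> 0})"
    using assms by (simp add: test_function_def compact_closure)
  then have "bounded {x. \<psi> x + c * \<theta> x \<noteq> 0}"
    by (rule bounded_subset) auto
  with assms show ?thesis
    by (auto simp: test_function_def compact_closure intro!: Ck_add Ck_mult Ck_const)
qed

lemma test_function_integrable: "test_function \<phi> \<Longrightarrow> integrable lborel \<phi>"
  using integrable_times_test_function(1)[OF continuous_imp_locally_integrable[of "\<lambda>x. 1"]] by simp

text \<open>
  Otherwise the constant function 1 would vanish almost everywhere by the fundamental lemma.
\<close>

lemma ex_test_function_integral: "\<exists>\<psi>::real \<Rightarrow> real. test_function \<psi> \<and> (\<integral>x. \<psi> x \<partial>lborel) \<noteq> 0"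
proof (rule ccontr)
  assume "\<not> ?thesis"
  then have "AE x::real in lborel. (1::real) = 0"
    by (intro fundamental_lemma continuous_imp_locally_integrable) auto
  then show False by (simp add: eventually_False ae_filter_eq_bot_iff)
qed

text \<open>
  The lemma of du Bois-Reymond. Fix a test function \<open>\<psi>0\<close> with nonzero integral. Any other test
  function becomes a derivative of a test function after subtracting a multiple of \<open>\<psi>0\<close>, so its
  integral against \<open>w\<close> is proportional to its integral.
\<close>

lemma weak_gradient_zero_imp_constant:
  assumes "has_weak_gradient (w :: real \<Rightarrow> real) (\<lambda>x. 0)"
  obtains \<kappa> where "AE x in lborel. w x = \<kappa>"
proof -
  have li: "locally_integrable w" using assms by (simp add: has_weak_gradient_def)
  obtain \<psi>0 :: "real \<Rightarrow> real" where \<psi>0: "test_function \<psi>0" "(\<integral>x. \<psi>0 x \<partial>lborel) \<noteq> 0"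
    using ex_test_function_integral by blast
  let ?c = "\<integral>x. \<psi>0 x \<partial>lborel" let ?\<kappa> = "(\<integral>x. w x * \<psi>0 x \<partial>lborel) / ?c"
  have "AE x in lborel. w x - ?\<kappa> = 0"
  proof (rule fundamental_lemma)
    show "locally_integrable (\<lambda>x. w x - ?\<kappa>)"
      by (intro locally_integrable_diff li continuous_imp_locally_integrable continuous_on_const)
    fix \<psi> :: "real \<Rightarrow> real" assume \<psi>: "test_function \<psi>"
    \<comment> \<open>This multiple of \<open>\<psi>0\<close> cancels the integral of \<open>\<psi>\<close>.\<close>
    define r where "r = - (\<integral>x. \<psi> x \<partial>lborel) / ?c"
    have "test_function (\<lambda>x. \<psi> x + r * \<psi>0 x)"
      using \<psi> \<psi>0(1) by (rule test_function_add_cmult)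
    moreover have "(\<integral>x. \<psi> x + r * \<psi>0 x \<partial>lborel) = 0"
      using \<psi> \<psi>0 by (simp add: test_function_integrable r_def)
    ultimately obtain \<phi> where \<phi>: "test_function \<phi>" "\<And>x. frechet_derivative \<phi> (at x) 1 = \<psi> x + r * \<psi>0 x"
      by (rule test_function_antiderivative) blast
    have "0 = (\<integral>x. w x * (\<psi> x + r * \<psi>0 x) \<partial>lborel)"
      using assms \<phi> by (auto simp: has_weak_gradient_def)
    also have "\<dots> = (\<integral>x. w x * \<psi> x + r * (w x * \<psi>0 x) \<partial>lborel)"
      by (simp add: algebra_simps)
    also have "\<dots> = (\<integral>x. w x * \<psi> x \<partial>lborel) + r * (\<integral>x. w x * \<psi>0 x \<partial>lborel)"
      using \<psi> \<psi>0 li by (simp add: integrable_times_test_function)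
    also have "\<dots> = (\<integral>x. w x * \<psi> x \<partial>lborel) - ?\<kappa> * (\<integral>x. \<psi> x \<partial>lborel)"
      by (simp add: r_def)
    also have "\<dots> = (\<integral>x. (w x - ?\<kappa>) * \<psi> x \<partial>lborel)"
      using \<psi> li by (simp add: left_diff_distrib integrable_times_test_function test_function_integrable)
    finally show "(\<integral>x. (w x - ?\<kappa>) * \<psi> x \<partial>lborel) = 0" by simp
  qed
  then show thesis by (intro that[of ?\<kappa>]) simp
qed

text \<open>
  The difference of \<open>g\<close> and an indefinite integral of \<open>G\<close> has weak derivative 0.
\<close>

lemma weak_gradient_imp_primitive:
  assumes g: "has_weak_gradient (g :: real \<Rightarrow> real) G"
  obtains h where "primitive h G" "AE x in lborel. g x = h x"
proof -
  have "locally_integrable G" using g by (simp add: has_weak_gradient_def)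
  then obtain h where h: "primitive h G" using ex_primitive by blast
  have "has_weak_gradient (\<lambda>x. g x - h x) (\<lambda>x. 0)"
    using has_weak_gradient_diff[OF g primitive_imp_weak_gradient[OF h]] by simp
  then obtain \<kappa> where "AE x in lborel. g x - h x = \<kappa>"
    by (rule weak_gradient_zero_imp_constant)
  then have "AE x in lborel. g x = h x + \<kappa>" by eventually_elim simp
  moreover have "primitive (\<lambda>x. h x + \<kappa>) G" using h by (simp add: primitive_def)
  ultimately show thesis using that by blast
qed

section \<open>Products of functions of one variable and Gaussian measures\<close>

lemma borel_measurable_of_weak_gradient:
  "has_weak_gradient g G \<Longrightarrow> g \<in> borel_measurable borel"
  "has_weak_gradient g G \<Longrightarrow> G \<in> borel_measurable borel"
  by (auto simp: has_weak_gradient_def locally_integrable_def)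

lemma lborel_prod_integral:
  fixes f :: "'a::euclidean_space \<Rightarrow> real \<Rightarrow> real"
  assumes f: "\<And>b. b \<in> Basis \<Longrightarrow> integrable lborel (f b)"
  shows "integrable lborel (\<lambda>x::'a. \<Prod>b\<in>Basis. f b (x \<bullet> b))"
    and "(\<integral>x. (\<Prod>b\<in>Basis. f b (x \<bullet> b)) \<partial>lborel) = (\<Prod>b\<in>Basis. \<integral>t. f b t \<partial>lborel)"
proof -
  interpret product_sigma_finite "\<lambda>_::'a. lborel :: real measure"
    by standard
  let ?T = "\<lambda>y::'a \<Rightarrow> real. \<Sum>b\<in>Basis. y b *\<^sub>R b"
  have [measurable]: "\<And>b. b \<in> Basis \<Longrightarrow> f b \<in> borel_measurable borel"
    using borel_measurable_integrable[OF f] by simp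
  have m: "(\<lambda>x::'a. \<Prod>b\<in>Basis. f b (x \<bullet> b)) \<in> borel_measurable borel"
    by measurable
  have T: "?T \<in> measurable (\<Pi>\<^sub>M b\<in>Basis. lborel) borel"
    by measurable
  have eq: "(\<Prod>b\<in>Basis. f b (?T y \<bullet> b)) = (\<Prod>b\<in>Basis. f b (y b))" for y
    by (intro prod.cong) (simp_all add: inner_sum_left_Basis)
  have "integrable (\<Pi>\<^sub>M b\<in>Basis. lborel) (\<lambda>y. \<Prod>b\<in>(Basis::'a set). f b (y b))"
    using f by (intro product_integrable_prod) auto
  then show "integrable lborel (\<lambda>x::'a. \<Prod>b\<in>Basis. f b (x \<bullet> b))"
    by (subst lborel_eq, subst integrable_distr_eq[OF T m]) (simp add: eq)
  have "(\<integral>x. (\<Prod>b\<in>Basis. f b (x \<bullet> b)) \<partial>lborel)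
      = (\<integral>y. (\<Prod>b\<in>Basis. f b (y b)) \<partial>(\<Pi>\<^sub>M b\<in>(Basis::'a set). lborel))"
    by (subst lborel_eq, subst integral_distr[OF T m]) (simp only: eq)
  also have "\<dots> = (\<Prod>b\<in>Basis. \<integral>t. f b t \<partial>lborel)"
    using f by (intro product_integral_prod) auto
  finally show "(\<integral>x. (\<Prod>b\<in>Basis. f b (x \<bullet> b)) \<partial>lborel) = (\<Prod>b\<in>Basis. \<integral>t. f b t \<partial>lborel)" .
qed

text \<open>
  Fubini, with the coordinate in direction \<open>b\<close> as the inner variable.
\<close>

lemma lborel_integral_line:
  fixes h :: "'a::euclidean_space \<Rightarrow> real"
  assumes h: "integrable lborel h" and b: "b \<in> Basis"
  shows "(\<integral>x. h x \<partial>lborel) =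
    (\<integral>y. (\<integral>t. h ((\<Sum>c\<in>Basis - {b}. y c *\<^sub>R c) + t *\<^sub>R b) \<partial>lborel) \<partial>(\<Pi>\<^sub>M c\<in>Basis - {b}. lborel))"
proof -
  interpret product_sigma_finite "\<lambda>_::'a. lborel :: real measure"
    by standard
  let ?T = "\<lambda>y::'a \<Rightarrow> real. \<Sum>b\<in>Basis. y b *\<^sub>R b"
  have T: "?T \<in> measurable (\<Pi>\<^sub>M b\<in>Basis. lborel) borel"
    by measurable
  have m: "h \<in> borel_measurable borel" using h by auto
  have B: "insert b (Basis - {b}) = Basis" using b by auto
  have "integrable (\<Pi>\<^sub>M b\<in>Basis. lborel) (\<lambda>y. h (?T y))"
    using h by (subst (asm) lborel_eq, subst (asm) integrable_distr_eq[OF T m])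
  then have i: "integrable (\<Pi>\<^sub>M b\<in>insert b (Basis - {b}). lborel) (\<lambda>y. h (?T y))"
    unfolding B .
  have upd: "?T (y(b := t)) = (\<Sum>c\<in>Basis - {b}. y c *\<^sub>R c) + t *\<^sub>R b" for y t
    using b by (simp add: sum.remove add.commute)
  have "(\<integral>x. h x \<partial>lborel) = (\<integral>y. h (?T y) \<partial>(\<Pi>\<^sub>M b\<in>insert b (Basis - {b}). lborel))"
    unfolding B by (subst lborel_eq, rule integral_distr[OF T m])
  also have "\<dots> = (\<integral>y. (\<integral>t. h (?T (y(b := t))) \<partial>lborel) \<partial>(\<Pi>\<^sub>M c\<in>Basis - {b}. lborel))"
    by (rule product_integral_insert[OF _ _ i]) auto
  finally show ?thesis by (simp only: upd)
qed

text \<open>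
  A compact set lies in a cube, and there the product of the restricted factors is integrable.
\<close>

lemma locally_integrable_prod:
  fixes f :: "'a::euclidean_space \<Rightarrow> real \<Rightarrow> real"
  assumes f: "\<And>b. b \<in> Basis \<Longrightarrow> locally_integrable (f b)"
  shows "locally_integrable (\<lambda>x::'a. \<Prod>b\<in>Basis. f b (x \<bullet> b))"
  unfolding locally_integrable_def set_integrable_def
proof (intro conjI allI impI)
  have [measurable]: "\<And>b. b \<in> Basis \<Longrightarrow> f b \<in> borel_measurable borel"
    using f by (simp add: locally_integrable_def)
  show "(\<lambda>x::'a. \<Prod>b\<in>Basis. f b (x \<bullet> b)) \<in> borel_measurable borel" by measurable
  fix K :: "'a set" assume K: "compact K"
  then have [measurable]: "K \<in> sets borel" by (simp add: borel_compact)
  obtain R where R: "\<And>x. x \<in> K \<Longrightarrow> norm x \<le> R"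
    using compact_imp_bounded[OF K] by (auto simp: bounded_iff)
  have "integrable lborel (\<lambda>x::'a. \<Prod>b\<in>Basis. indicator {-R..R} (x \<bullet> b) * f b (x \<bullet> b))"
    using locally_integrable_interval[OF f] by (intro lborel_prod_integral) (simp add: set_integrable_def)
  then show "integrable lborel (\<lambda>x. indicator K x *\<^sub>R (\<Prod>b\<in>Basis. f b (x \<bullet> b)))"
  proof (rule Bochner_Integration.integrable_bound)
    have "x \<bullet> b \<in> {-R..R}" if "x \<in> K" "b \<in> Basis" for x b
      using Basis_le_norm[OF that(2), of x] R[OF that(1)] by (simp add: abs_le_iff)
    then have "(\<Prod>b\<in>Basis. indicator {-R..R} (x \<bullet> b) * f b (x \<bullet> b)) = (\<Prod>b\<in>Basis. f b (x \<bullet> b))"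
      if "x \<in> K" for x
      using that by (intro prod.cong) auto
    then show "AE x in lborel. norm (indicator K x *\<^sub>R (\<Prod>b\<in>Basis. f b (x \<bullet> b)))
        \<le> norm (\<Prod>b\<in>Basis. indicator {-R..R} (x \<bullet> b) * f b (x \<bullet> b))"
      by (intro AE_I2) (auto split: split_indicator)
  qed measurable
qed

lemma locally_integrable_sum:
  assumes "\<And>i. i \<in> I \<Longrightarrow> locally_integrable (f i)"
  shows "locally_integrable (\<lambda>x. \<Sum>i\<in>I. f i x)"
  using assms unfolding locally_integrable_def set_integrable_def scaleR_sum_right
  by (intro conjI allI impI borel_measurable_sum Bochner_Integration.integrable_sum) blast+

lemma locally_integrable_scaleR:
  fixes h :: "'a::euclidean_space \<Rightarrow> real" and b :: "'b::euclidean_space"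
  assumes "locally_integrable h"
  shows "locally_integrable (\<lambda>x. h x *\<^sub>R b)"
  unfolding locally_integrable_def set_integrable_def
proof (intro conjI allI impI)
  have [measurable]: "h \<in> borel_measurable borel" using assms by (simp add: locally_integrable_def)
  show "(\<lambda>x. h x *\<^sub>R b) \<in> borel_measurable borel" by measurable
  fix K :: "'a set" assume "compact K"
  then have "integrable lborel (\<lambda>x. (indicator K x *\<^sub>R h x) *\<^sub>R b)"
    using assms by (intro integrable_scaleR_left) (simp add: locally_integrable_def set_integrable_def)
  then show "integrable lborel (\<lambda>x. indicator K x *\<^sub>R h x *\<^sub>R b)" by simp
qed

definition tensor :: "('a::euclidean_space \<Rightarrow> real \<Rightarrow> real) \<Rightarrow> 'a \<Rightarrow> real" where
  "tensor f x = (\<Prod>b\<in>Basis. f b (x \<bullet> b))"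

text \<open>
  If \<open>g c\<close> is the derivative of \<open>f c\<close> for all \<open>c\<close>, this is the partial derivative of \<open>tensor f\<close>
  in direction \<open>b\<close>. With other choices of \<open>f\<close> and \<open>g\<close> it is the summand that the direction \<open>b\<close>
  contributes to the Fisher information and to the entropy density of a product.
\<close>

definition partial :: "('a::euclidean_space \<Rightarrow> real \<Rightarrow> real) \<Rightarrow> ('a \<Rightarrow> real \<Rightarrow> real) \<Rightarrow> 'a \<Rightarrow> 'a \<Rightarrow> real" where
  "partial f g b x = g b (x \<bullet> b) * (\<Prod>c\<in>Basis - {b}. f c (x \<bullet> c))"

lemma partial_eq_tensor: "b \<in> Basis \<Longrightarrow> partial f g b = tensor (\<lambda>c. if c = b then g b else f c)"
  by (auto simp: fun_eq_iff partial_def tensor_def prod.remove intro!: prod.cong)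

lemma tensor_eq: "b \<in> Basis \<Longrightarrow> tensor f x = f b (x \<bullet> b) * (\<Prod>c\<in>Basis - {b}. f c (x \<bullet> c))"
  by (simp add: tensor_def prod.remove)

text \<open>
  On each line in direction \<open>b\<close> all factors but \<open>f b\<close> are constant, and the test function
  restricts to a test function. The one-dimensional identity, integrated over all these lines, is
  the identity for the product.
\<close>

lemma has_weak_gradient_tensor:
  fixes f :: "'a::euclidean_space \<Rightarrow> real \<Rightarrow> real"
  assumes fg: "\<And>b. b \<in> Basis \<Longrightarrow> has_weak_gradient (f b) (g b)"
  shows "has_weak_gradient (tensor f) (\<lambda>x. \<Sum>b\<in>Basis. partial f g b x *\<^sub>R b)"
  unfolding has_weak_gradient_def
proof (intro conjI allI impI ballI)
  have l: "locally_integrable (f b)" "locally_integrable (g b)" if "b \<in> Basis" for b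
    using fg[OF that] by (auto simp: has_weak_gradient_def)
  show F: "locally_integrable (tensor f)"
    unfolding tensor_def[abs_def] using l by (intro locally_integrable_prod)
  have G: "locally_integrable (partial f g b)" if "b \<in> Basis" for b
    unfolding partial_eq_tensor[OF that] tensor_def[abs_def] using l by (intro locally_integrable_prod) auto
  then show "locally_integrable (\<lambda>x. \<Sum>b\<in>Basis. partial f g b x *\<^sub>R b)"
    by (intro locally_integrable_sum locally_integrable_scaleR)
  fix \<phi> :: "'a \<Rightarrow> real" and b :: 'a assume \<phi>: "test_function \<phi>" and b: "b \<in> Basis"
  let ?p = "\<lambda>y::'a \<Rightarrow> real. \<Sum>c\<in>Basis - {b}. y c *\<^sub>R c" and ?P = "\<lambda>y::'a \<Rightarrow> real. \<Prod>c\<in>Basis - {b}. f c (y c)"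
  have pb: "(?p y + t *\<^sub>R b) \<bullet> b = t" for y t
    using b by (simp add: inner_add_left inner_sum_left inner_Basis)
  have pc: "(?p y + t *\<^sub>R b) \<bullet> c = y c" if "c \<in> Basis - {b}" for c y t
  proof -
    have "(?p y + t *\<^sub>R b) \<bullet> c = (\<Sum>i\<in>Basis - {b}. y i * (i \<bullet> c))"
      using b that by (auto simp: inner_add_left inner_sum_left inner_not_same_Basis)
    also have "\<dots> = y c * (c \<bullet> c) + (\<Sum>i\<in>Basis - {b} - {c}. y i * (i \<bullet> c))"
      using that by (intro sum.remove) auto
    also have "(\<Sum>i\<in>Basis - {b} - {c}. y i * (i \<bullet> c)) = 0"
      using that by (intro sum.neutral) (auto simp: inner_not_same_Basis)
    finally show ?thesis using that by simp
  qed
  have tensor_line: "tensor f (?p y + t *\<^sub>R b) = f b t * ?P y" for y t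
    unfolding tensor_eq[OF b] pb by (simp add: pc)
  have partial_line: "partial f g b (?p y + t *\<^sub>R b) = g b t * ?P y" for y t
    unfolding partial_def pb by (simp add: pc)
  have d: "\<phi> differentiable at x" for x
  proof -
    have "Ck 1 \<phi>" using \<phi> by (simp add: test_function_def)
    then show ?thesis by simp
  qed
  have line: "(\<integral>t. f b t * frechet_derivative \<phi> (at (x + t *\<^sub>R b)) b \<partial>lborel) = - (\<integral>t. g b t * \<phi> (x + t *\<^sub>R b) \<partial>lborel)" for x
  proof -
    have "frechet_derivative (\<lambda>t. \<phi> (x + t *\<^sub>R b)) (at t) 1 = frechet_derivative \<phi> (at (x + t *\<^sub>R b)) b" for t
      using fun_cong[OF frechet_derivative_at[OF line_derivative[of \<phi> x b t]], of 1] d by simp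
    with fg[OF b] test_function_line[OF \<phi> b, of x] show ?thesis
      by (auto simp: has_weak_gradient_def)
  qed
  have "(\<integral>x. tensor f x * frechet_derivative \<phi> (at x) b \<partial>lborel) =
      (\<integral>y. ?P y * (\<integral>t. f b t * frechet_derivative \<phi> (at (?p y + t *\<^sub>R b)) b \<partial>lborel) \<partial>(\<Pi>\<^sub>M c\<in>Basis - {b}. lborel))"
    by (subst lborel_integral_line[OF integrable_times_test_function(2)[OF F \<phi> b] b])
      (simp add: tensor_line mult_ac flip: integral_mult_right_zero)
  also have "\<dots> = - (\<integral>y. ?P y * (\<integral>t. g b t * \<phi> (?p y + t *\<^sub>R b) \<partial>lborel) \<partial>(\<Pi>\<^sub>M c\<in>Basis - {b}. lborel))"
    by (simp add: line)
  also have "(\<integral>y. ?P y * (\<integral>t. g b t * \<phi> (?p y + t *\<^sub>R b) \<partial>lborel) \<partial>(\<Pi>\<^sub>M c\<in>Basis - {b}. lborel)) =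
      (\<integral>x. partial f g b x * \<phi> x \<partial>lborel)"
    by (subst lborel_integral_line[OF integrable_times_test_function(1)[OF G \<phi>] b])
      (simp_all add: b partial_line mult_ac flip: integral_mult_right_zero)
  also have "(\<integral>x. partial f g b x * \<phi> x \<partial>lborel) = (\<integral>x. ((\<Sum>b\<in>Basis. partial f g b x *\<^sub>R b) \<bullet> b) * \<phi> x \<partial>lborel)"
    using b by (simp add: inner_sum_left_Basis)
  finally show "(\<integral>x. tensor f x * frechet_derivative \<phi> (at x) b \<partial>lborel) =
      - (\<integral>x. ((\<Sum>b\<in>Basis. partial f g b x *\<^sub>R b) \<bullet> b) * \<phi> x \<partial>lborel)" .
qed

text \<open>
  The centred normal distribution with covariance \<open>\<sigma>\<^sup>2\<close> times the identity. Both weights of the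
  theorem are of this form, with \<open>\<sigma> = 1\<close> and with \<open>\<sigma> = 1 / sqrt (2 * pi)\<close>.
\<close>

definition gaussian :: "real \<Rightarrow> 'a::euclidean_space measure" where
  "gaussian \<sigma> = density lborel (\<lambda>x. ennreal (tensor (\<lambda>_. normal_density 0 \<sigma>) x))"

lemma borel_measurable_tensor[measurable]:
  assumes f: "\<And>b. b \<in> Basis \<Longrightarrow> f b \<in> borel_measurable borel"
  shows "tensor f \<in> borel_measurable borel"
  unfolding tensor_def[abs_def]
proof (rule borel_measurable_prod)
  fix b :: 'a assume "b \<in> Basis"
  have "(\<lambda>x. x \<bullet> b) \<in> borel_measurable borel" by simp
  from measurable_compose[OF this f[OF \<open>b \<in> Basis\<close>]]
  show "(\<lambda>x. f b (x \<bullet> b)) \<in> borel_measurable borel" .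
qed

lemma sets_gaussian[simp, measurable_cong]: "sets (gaussian \<sigma>) = sets borel"
  by (simp add: gaussian_def)

lemma space_gaussian[simp]: "space (gaussian \<sigma>) = UNIV"
  by (simp add: gaussian_def)

lemma gaussian_real: "(gaussian \<sigma> :: real measure) = density lborel (\<lambda>x. ennreal (normal_density 0 \<sigma> x))"
  by (simp add: gaussian_def tensor_def)

lemma AE_gaussian_iff:
  assumes "0 < \<sigma>"
  shows "(AE x in gaussian \<sigma>. P x) \<longleftrightarrow> (AE x in lborel. P x)"
  unfolding gaussian_def
  by (subst AE_density) (auto simp: tensor_def prod_pos normal_density_pos assms ennreal_less_zero_iff)

lemma prob_space_gaussian_real: "0 < \<sigma> \<Longrightarrow> prob_space (gaussian \<sigma> :: real measure)"
  using prob_space_normal_density[of \<sigma> 0] by (simp add: gaussian_real)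

lemma nn_integral_gaussian_prod:
  fixes h :: "'a::euclidean_space \<Rightarrow> real \<Rightarrow> ennreal"
  assumes [measurable]: "\<And>b. b \<in> Basis \<Longrightarrow> h b \<in> borel_measurable borel"
  shows "(\<integral>\<^sup>+x. (\<Prod>b\<in>Basis. h b (x \<bullet> b)) \<partial>(gaussian \<sigma> :: 'a measure)) = (\<Prod>b\<in>Basis. \<integral>\<^sup>+t. h b t \<partial>gaussian \<sigma>)"
proof -
  have "(\<integral>\<^sup>+x. (\<Prod>b\<in>Basis. h b (x \<bullet> b)) \<partial>(gaussian \<sigma> :: 'a measure))
      = (\<integral>\<^sup>+x. (\<Prod>b\<in>Basis. ennreal (normal_density 0 \<sigma> (x \<bullet> b)) * h b (x \<bullet> b)) \<partial>lborel)"
    unfolding gaussian_def by (subst nn_integral_density) (simp_all add: tensor_def prod.distrib prod_ennreal)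
  also have "\<dots> = (\<Prod>b\<in>Basis. \<integral>\<^sup>+t. ennreal (normal_density 0 \<sigma> t) * h b t \<partial>lborel)"
    by (rule nn_integral_lborel_prod) auto
  also have "\<dots> = (\<Prod>b\<in>Basis. \<integral>\<^sup>+t. h b t \<partial>gaussian \<sigma>)"
    unfolding gaussian_real by (intro prod.cong) (simp_all add: nn_integral_density)
  finally show ?thesis .
qed

lemma gaussian_tensor_integral:
  fixes f :: "'a::euclidean_space \<Rightarrow> real \<Rightarrow> real"
  assumes f: "\<And>b. b \<in> Basis \<Longrightarrow> integrable (gaussian \<sigma>) (f b)"
  shows "integrable (gaussian \<sigma>) (tensor f)"
    and "(\<integral>x. tensor f x \<partial>gaussian \<sigma>) = (\<Prod>b\<in>Basis. \<integral>t. f b t \<partial>gaussian \<sigma>)"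
proof -
  have [measurable]: "f b \<in> borel_measurable borel" if "b \<in> Basis" for b
    using borel_measurable_integrable[OF f[OF that]] by simp
  have i: "integrable lborel (\<lambda>t. normal_density 0 \<sigma> t * f b t)" if "b \<in> Basis" for b
    using f[OF that] that unfolding gaussian_real by (subst (asm) integrable_density) auto
  have eq: "tensor (\<lambda>_. normal_density 0 \<sigma>) x *\<^sub>R tensor f x = (\<Prod>b\<in>Basis. normal_density 0 \<sigma> (x \<bullet> b) * f b (x \<bullet> b))" for x :: 'a
    by (simp add: tensor_def prod.distrib)
  have nn: "0 \<le> tensor (\<lambda>_. normal_density 0 \<sigma>) x" for x :: 'a
    by (simp add: tensor_def prod_nonneg)
  show "integrable (gaussian \<sigma>) (tensor f)"
    unfolding gaussian_def by (subst integrable_density) (auto simp only: eq intro!: lborel_prod_integral i nn measurable, measurable)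
  have "(\<integral>x. tensor f x \<partial>gaussian \<sigma>) = (\<integral>x. (\<Prod>b\<in>Basis. normal_density 0 \<sigma> (x \<bullet> b) * f b (x \<bullet> b)) \<partial>lborel)"
    unfolding gaussian_def by (subst integral_density) (simp_all add: nn flip: eq)
  also have "\<dots> = (\<Prod>b\<in>Basis. \<integral>t. normal_density 0 \<sigma> t * f b t \<partial>lborel)"
    by (rule lborel_prod_integral(2)[OF i])
  also have "\<dots> = (\<Prod>b\<in>Basis. \<integral>t. f b t \<partial>gaussian \<sigma>)"
    unfolding gaussian_real by (intro prod.cong refl) (subst integral_density, auto)
  finally show "(\<integral>x. tensor f x \<partial>gaussian \<sigma>) = (\<Prod>b\<in>Basis. \<integral>t. f b t \<partial>gaussian \<sigma>)" .
qed

text \<open>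
  Each summand is a product in separate variables in which every factor but \<open>e b\<close> has integral 1.
  The entropy and the gradient term of both deficits of a product have this shape.
\<close>

lemma integral_sum_partial:
  fixes q e :: "'a::euclidean_space \<Rightarrow> real \<Rightarrow> real"
  assumes e: "\<And>b. b \<in> Basis \<Longrightarrow> integrable (gaussian \<sigma>) (e b)"
    and q: "\<And>b. b \<in> Basis \<Longrightarrow> integrable (gaussian \<sigma>) (q b)"
    and q1: "\<And>b. b \<in> Basis \<Longrightarrow> (\<integral>t. q b t \<partial>gaussian \<sigma>) = 1"
  shows "(\<integral>x. (\<Sum>b\<in>Basis. partial q e b x) \<partial>gaussian \<sigma>) = (\<Sum>b\<in>Basis. \<integral>t. e b t \<partial>gaussian \<sigma>)"
proof -
  have *: "integrable (gaussian \<sigma>) (if c = b then e b else q c)" if "b \<in> Basis" "c \<in> Basis" for b c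
    using that e q by simp
  have "integrable (gaussian \<sigma>) (partial q e b)" if "b \<in> Basis" for b
    unfolding partial_eq_tensor[OF that] by (rule gaussian_tensor_integral(1)[OF *[OF that]])
  then have "(\<integral>x. (\<Sum>b\<in>Basis. partial q e b x) \<partial>gaussian \<sigma>) = (\<Sum>b\<in>Basis. \<integral>x. partial q e b x \<partial>gaussian \<sigma>)"
    by (rule Bochner_Integration.integral_sum)
  also have "\<dots> = (\<Sum>b\<in>Basis. \<integral>t. e b t \<partial>gaussian \<sigma>)"
  proof (rule sum.cong[OF refl])
    fix b :: 'a assume that: "b \<in> Basis"
    have "(\<integral>x. partial q e b x \<partial>gaussian \<sigma>) = (\<Prod>c\<in>Basis. \<integral>t. (if c = b then e b else q c) t \<partial>gaussian \<sigma>)"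
      unfolding partial_eq_tensor[OF that] by (rule gaussian_tensor_integral(2)[OF *[OF that]])
    also have "\<dots> = (\<integral>t. e b t \<partial>gaussian \<sigma>) * (\<Prod>c\<in>Basis - {b}. 1)"
      using that by (subst prod.remove[OF _ that]) (auto simp: q1 intro!: prod.cong)
    finally show "(\<integral>x. partial q e b x \<partial>gaussian \<sigma>) = (\<integral>t. e b t \<partial>gaussian \<sigma>)" by simp
  qed
  finally show ?thesis .
qed

section \<open>The Sobolev norm and the deficits of a product\<close>

lemma has_weak_gradient_one: "has_weak_gradient (\<lambda>_::'a::euclidean_space. 1) (\<lambda>_. 0)"
proof -
  have "primitive (\<lambda>_. 1) (\<lambda>_. 0)"
    by (rule primitive_C1) auto
  then have "has_weak_gradient (tensor (\<lambda>_::'a. \<lambda>_. 1)) (\<lambda>x. \<Sum>b\<in>Basis. partial (\<lambda>_::'a. \<lambda>_. 1) (\<lambda>_ _. 0) b x *\<^sub>R b)"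
    by (intro has_weak_gradient_tensor primitive_imp_weak_gradient)
  then show ?thesis
    by (simp add: tensor_def[abs_def] partial_def)
qed

lemma W11_norm_minus_1:
  assumes \<sigma>: "0 < \<sigma>" and g: "has_weak_gradient g G"
  shows "W11_norm (gaussian \<sigma>) (\<lambda>x. g x - 1) =
    (\<integral>\<^sup>+x. ennreal \<bar>g x - 1\<bar> \<partial>gaussian \<sigma>) + (\<integral>\<^sup>+x. ennreal (norm (G x)) \<partial>gaussian \<sigma>)"
proof -
  have h: "has_weak_gradient (\<lambda>x. g x - 1) G"
    using has_weak_gradient_diff[OF g has_weak_gradient_one] by simp
  have "(\<integral>\<^sup>+x. ennreal (norm (weak_gradient (\<lambda>x. g x - 1) x)) \<partial>gaussian \<sigma>) = (\<integral>\<^sup>+x. ennreal (norm (G x)) \<partial>gaussian \<sigma>)"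
    by (rule nn_integral_cong_AE) (use weak_gradient_AE_eq[OF h] in \<open>simp add: AE_gaussian_iff[OF \<sigma>], eventually_elim, simp\<close>)
  with h show ?thesis
    unfolding W11_norm_def weakly_differentiable_def by auto
qed

lemma nn_integral_gaussian_prod_le:
  fixes h :: "'a::euclidean_space \<Rightarrow> real \<Rightarrow> ennreal"
  assumes m: "\<And>b. b \<in> Basis \<Longrightarrow> h b \<in> borel_measurable borel" and k: "k \<in> Basis"
    and le: "\<And>b. b \<in> Basis \<Longrightarrow> b \<noteq> k \<Longrightarrow> (\<integral>\<^sup>+t. h b t \<partial>gaussian \<sigma>) \<le> 1"
  shows "(\<integral>\<^sup>+x. (\<Prod>b\<in>Basis. h b (x \<bullet> b)) \<partial>(gaussian \<sigma> :: 'a measure)) \<le> (\<integral>\<^sup>+t. h k t \<partial>gaussian \<sigma>)"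
proof -
  have "(\<integral>\<^sup>+x. (\<Prod>b\<in>Basis. h b (x \<bullet> b)) \<partial>(gaussian \<sigma> :: 'a measure))
      = (\<integral>\<^sup>+t. h k t \<partial>gaussian \<sigma>) * (\<Prod>b\<in>Basis - {k}. \<integral>\<^sup>+t. h b t \<partial>gaussian \<sigma>)"
    using nn_integral_gaussian_prod[of h \<sigma>, OF m] prod.remove[OF finite_Basis k] by simp
  also have "\<dots> \<le> (\<integral>\<^sup>+t. h k t \<partial>gaussian \<sigma>) * 1"
    by (intro mult_left_mono prod_le_1) (auto intro: le)
  finally show ?thesis by simp
qed

text \<open>
  Telescoping: adding a factor \<open>p\<close> to a product \<open>P\<close> uses \<open>p P - 1 = (p - 1) P + (P - 1)\<close>, and
  \<open>P\<close> has integral at most 1 and depends on other coordinates than \<open>p\<close>.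
\<close>

lemma L1_tensor_minus_1:
  fixes f :: "'a::euclidean_space \<Rightarrow> real \<Rightarrow> real"
  assumes \<sigma>: "0 < \<sigma>"
    and f: "\<And>b. b \<in> Basis \<Longrightarrow> f b \<in> borel_measurable borel" "\<And>b t. b \<in> Basis \<Longrightarrow> 0 \<le> f b t"
    and le: "\<And>b. b \<in> Basis \<Longrightarrow> (\<integral>\<^sup>+t. ennreal (f b t) \<partial>gaussian \<sigma>) \<le> 1"
    and S: "S \<subseteq> Basis"
  shows "(\<integral>\<^sup>+x. ennreal \<bar>(\<Prod>b\<in>S. f b (x \<bullet> b)) - 1\<bar> \<partial>(gaussian \<sigma> :: 'a measure))
    \<le> (\<Sum>b\<in>S. \<integral>\<^sup>+t. ennreal \<bar>f b t - 1\<bar> \<partial>gaussian \<sigma>)"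
proof -
  interpret prob_space "gaussian \<sigma> :: real measure" by (rule prob_space_gaussian_real[OF \<sigma>])
  have one: "(\<integral>\<^sup>+t. 1 \<partial>(gaussian \<sigma> :: real measure)) = 1"
    using emeasure_space_1 by simp
  have "finite S" using S by (rule finite_subset) simp
  from this S show ?thesis
  proof (induction S rule: finite_induct)
    case (insert k S)
    then have k: "k \<in> Basis" and S: "S \<subseteq> Basis" "k \<notin> S" "finite S" by auto
    have [measurable]: "(\<lambda>x. f b (x \<bullet> b)) \<in> borel_measurable borel" if "b \<in> insert k S" for b
    proof -
      have "(\<lambda>x. x \<bullet> b) \<in> borel_measurable borel" by simp
      from measurable_compose[OF this f(1)] that k S show ?thesis by auto
    qed
    define h where "h b t = (if b = k then ennreal \<bar>f k t - 1\<bar> else if b \<in> S then ennreal (f b t) else 1)" for b t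
    have h: "ennreal (\<bar>f k (x \<bullet> k) - 1\<bar> * (\<Prod>b\<in>S. f b (x \<bullet> b))) = (\<Prod>b\<in>Basis. h b (x \<bullet> b))" for x
    proof -
      have "(\<Prod>b\<in>Basis. h b (x \<bullet> b)) = (\<Prod>b\<in>insert k S. h b (x \<bullet> b))"
        using k S by (intro prod.mono_neutral_right) (auto simp: h_def)
      also have "\<dots> = h k (x \<bullet> k) * (\<Prod>b\<in>S. h b (x \<bullet> b))"
        using S by simp
      also have "(\<Prod>b\<in>S. h b (x \<bullet> b)) = (\<Prod>b\<in>S. ennreal (f b (x \<bullet> b)))"
        by (rule prod.cong) (use S in \<open>auto simp: h_def\<close>)
      also have "h k (x \<bullet> k) * \<dots> = ennreal \<bar>f k (x \<bullet> k) - 1\<bar> * ennreal (\<Prod>b\<in>S. f b (x \<bullet> b))"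
        using S f(2) by (subst prod_ennreal) (auto simp: h_def)
      also have "\<dots> = ennreal (\<bar>f k (x \<bullet> k) - 1\<bar> * (\<Prod>b\<in>S. f b (x \<bullet> b)))"
        using S f(2) by (intro ennreal_mult[symmetric] prod_nonneg) auto
      finally show ?thesis by simp
    qed
    have "(\<integral>\<^sup>+x. ennreal \<bar>(\<Prod>b\<in>insert k S. f b (x \<bullet> b)) - 1\<bar> \<partial>(gaussian \<sigma> :: 'a measure))
      \<le> (\<integral>\<^sup>+x. ennreal (\<bar>f k (x \<bullet> k) - 1\<bar> * (\<Prod>b\<in>S. f b (x \<bullet> b)))
            + ennreal \<bar>(\<Prod>b\<in>S. f b (x \<bullet> b)) - 1\<bar> \<partial>(gaussian \<sigma> :: 'a measure))"
    proof (rule nn_integral_mono)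
      fix x :: 'a
      let ?P = "\<Prod>b\<in>S. f b (x \<bullet> b)"
      have P: "0 \<le> ?P" using S f(2) by (intro prod_nonneg) auto
      have "(\<Prod>b\<in>insert k S. f b (x \<bullet> b)) - 1 = (f k (x \<bullet> k) - 1) * ?P + (?P - 1)"
        using S by (simp add: algebra_simps)
      then have "\<bar>(\<Prod>b\<in>insert k S. f b (x \<bullet> b)) - 1\<bar> \<le> \<bar>f k (x \<bullet> k) - 1\<bar> * ?P + \<bar>?P - 1\<bar>"
        using abs_triangle_ineq[of "(f k (x \<bullet> k) - 1) * ?P" "?P - 1"] P by (simp add: abs_mult)
      then have "ennreal \<bar>(\<Prod>b\<in>insert k S. f b (x \<bullet> b)) - 1\<bar> \<le> ennreal (\<bar>f k (x \<bullet> k) - 1\<bar> * ?P + \<bar>?P - 1\<bar>)"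
        by (rule ennreal_leI)
      also have "\<dots> = ennreal (\<bar>f k (x \<bullet> k) - 1\<bar> * ?P) + ennreal \<bar>?P - 1\<bar>"
        using P by (intro ennreal_plus) auto
      finally show "ennreal \<bar>(\<Prod>b\<in>insert k S. f b (x \<bullet> b)) - 1\<bar> \<le> ennreal (\<bar>f k (x \<bullet> k) - 1\<bar> * ?P) + ennreal \<bar>?P - 1\<bar>" .
    qed
    also have "\<dots> = (\<integral>\<^sup>+x. ennreal (\<bar>f k (x \<bullet> k) - 1\<bar> * (\<Prod>b\<in>S. f b (x \<bullet> b))) \<partial>(gaussian \<sigma> :: 'a measure))
        + (\<integral>\<^sup>+x. ennreal \<bar>(\<Prod>b\<in>S. f b (x \<bullet> b)) - 1\<bar> \<partial>(gaussian \<sigma> :: 'a measure))"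
      by (rule nn_integral_add) measurable
    also have "(\<integral>\<^sup>+x. ennreal (\<bar>f k (x \<bullet> k) - 1\<bar> * (\<Prod>b\<in>S. f b (x \<bullet> b))) \<partial>(gaussian \<sigma> :: 'a measure))
        \<le> (\<integral>\<^sup>+t. h k t \<partial>gaussian \<sigma>)"
      unfolding h
    proof (rule nn_integral_gaussian_prod_le[OF _ k])
      fix b :: 'a assume b: "b \<in> Basis"
      note [measurable] = f(1)[OF k] f(1)[OF b]
      show "h b \<in> borel_measurable borel"
        unfolding h_def[abs_def] by (cases "b = k"; cases "b \<in> S") simp_all
      show "b \<noteq> k \<Longrightarrow> (\<integral>\<^sup>+t. h b t \<partial>gaussian \<sigma>) \<le> 1"
        using le[OF b] one by (cases "b \<in> S") (auto simp: h_def)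
    qed
    also have "(\<integral>\<^sup>+t. h k t \<partial>gaussian \<sigma>) = (\<integral>\<^sup>+t. ennreal \<bar>f k t - 1\<bar> \<partial>gaussian \<sigma>)"
      by (simp add: h_def)
    finally show ?case
      using insert.IH S by (auto intro: order_trans add_left_mono)
  qed simp
qed

text \<open>
  For the gradient, the Euclidean norm is at most the sum of the absolute values of the partial
  derivatives, and each of these has the \<open>L\<^sup>1\<close> norm of the derivative of one factor, times factors
  at most 1.
\<close>

lemma W11_norm_tensor_minus_1:
  fixes f :: "'a::euclidean_space \<Rightarrow> real \<Rightarrow> real"
  assumes \<sigma>: "0 < \<sigma>" and fg: "\<And>b. b \<in> Basis \<Longrightarrow> has_weak_gradient (f b) (g b)"
    and nn: "\<And>b t. b \<in> Basis \<Longrightarrow> 0 \<le> f b t"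
    and le: "\<And>b. b \<in> Basis \<Longrightarrow> (\<integral>\<^sup>+t. ennreal (f b t) \<partial>gaussian \<sigma>) \<le> 1"
  shows "W11_norm (gaussian \<sigma>) (\<lambda>x. tensor f x - 1) \<le> (\<Sum>b\<in>Basis. W11_norm (gaussian \<sigma>) (\<lambda>t. f b t - 1))"
proof -
  have m: "f b \<in> borel_measurable borel" "g b \<in> borel_measurable borel" if "b \<in> Basis" for b
    using fg[OF that] by (auto dest: borel_measurable_of_weak_gradient)
  have "(\<integral>\<^sup>+x. ennreal (norm (\<Sum>b\<in>Basis. partial f g b x *\<^sub>R b)) \<partial>gaussian \<sigma>)
      \<le> (\<integral>\<^sup>+x. (\<Sum>b\<in>Basis. ennreal \<bar>partial f g b x\<bar>) \<partial>gaussian \<sigma>)"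
  proof (rule nn_integral_mono)
    fix x :: 'a
    have "norm (\<Sum>b\<in>Basis. partial f g b x *\<^sub>R b) \<le> (\<Sum>b\<in>Basis. \<bar>partial f g b x\<bar>)"
      by (rule order_trans[OF norm_sum]) simp
    then show "ennreal (norm (\<Sum>b\<in>Basis. partial f g b x *\<^sub>R b)) \<le> (\<Sum>b\<in>Basis. ennreal \<bar>partial f g b x\<bar>)"
      by (subst sum_ennreal) (auto intro: ennreal_leI)
  qed
  also have "\<dots> = (\<Sum>b\<in>Basis. \<integral>\<^sup>+x. ennreal \<bar>partial f g b x\<bar> \<partial>gaussian \<sigma>)"
  proof (rule nn_integral_sum)
    fix b :: 'a assume "b \<in> Basis"
    then have "partial f g b \<in> borel_measurable borel"
      unfolding partial_eq_tensor[OF \<open>b \<in> Basis\<close>] using m by (intro borel_measurable_tensor) auto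
    then show "(\<lambda>x. ennreal \<bar>partial f g b x\<bar>) \<in> borel_measurable (gaussian \<sigma>)"
      by simp
  qed
  also have "\<dots> \<le> (\<Sum>b\<in>Basis. \<integral>\<^sup>+t. ennreal \<bar>g b t\<bar> \<partial>gaussian \<sigma>)"
  proof (rule sum_mono)
    fix b :: 'a assume b: "b \<in> Basis"
    let ?h = "\<lambda>c t. ennreal \<bar>(if c = b then g b else f c) t\<bar>"
    have "(\<integral>\<^sup>+x. ennreal \<bar>partial f g b x\<bar> \<partial>gaussian \<sigma>) = (\<integral>\<^sup>+x. (\<Prod>c\<in>Basis. ?h c (x \<bullet> c)) \<partial>gaussian \<sigma>)"
      unfolding partial_eq_tensor[OF b] tensor_def abs_prod by (subst prod_ennreal) auto
    also have "\<dots> \<le> (\<integral>\<^sup>+t. ?h b t \<partial>gaussian \<sigma>)"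
    proof (rule nn_integral_gaussian_prod_le[OF _ b])
      fix c :: 'a assume c: "c \<in> Basis"
      show "?h c \<in> borel_measurable borel" using m b c by simp
      show "c \<noteq> b \<Longrightarrow> (\<integral>\<^sup>+t. ?h c t \<partial>gaussian \<sigma>) \<le> 1" using le[OF c] nn[OF c] by simp
    qed
    finally show "(\<integral>\<^sup>+x. ennreal \<bar>partial f g b x\<bar> \<partial>gaussian \<sigma>) \<le> (\<integral>\<^sup>+t. ennreal \<bar>g b t\<bar> \<partial>gaussian \<sigma>)"
      by simp
  qed
  finally have grad: "(\<integral>\<^sup>+x. ennreal (norm (\<Sum>b\<in>Basis. partial f g b x *\<^sub>R b)) \<partial>gaussian \<sigma>)
      \<le> (\<Sum>b\<in>Basis. \<integral>\<^sup>+t. ennreal \<bar>g b t\<bar> \<partial>gaussian \<sigma>)" .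
  have "W11_norm (gaussian \<sigma>) (\<lambda>x. tensor f x - 1) = (\<integral>\<^sup>+x. ennreal \<bar>tensor f x - 1\<bar> \<partial>gaussian \<sigma>)
      + (\<integral>\<^sup>+x. ennreal (norm (\<Sum>b\<in>Basis. partial f g b x *\<^sub>R b)) \<partial>gaussian \<sigma>)"
    by (rule W11_norm_minus_1[OF \<sigma> has_weak_gradient_tensor[OF fg]])
  also have "\<dots> \<le> (\<Sum>b\<in>Basis. \<integral>\<^sup>+t. ennreal \<bar>f b t - 1\<bar> \<partial>gaussian \<sigma>) + (\<Sum>b\<in>Basis. \<integral>\<^sup>+t. ennreal \<bar>g b t\<bar> \<partial>gaussian \<sigma>)"
    unfolding tensor_def using m nn le by (intro add_mono grad L1_tensor_minus_1 \<sigma>) auto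
  also have "\<dots> = (\<Sum>b\<in>Basis. W11_norm (gaussian \<sigma>) (\<lambda>t. f b t - 1))"
    unfolding sum.distrib[symmetric] by (intro sum.cong refl) (simp add: W11_norm_minus_1[OF \<sigma> fg])
  finally show ?thesis .
qed

lemma norm_square_sum_Basis:
  "(norm (\<Sum>b\<in>Basis. r b *\<^sub>R b :: 'a::euclidean_space))\<^sup>2 = (\<Sum>b\<in>Basis. (r b)\<^sup>2)"
  unfolding power2_norm_eq_inner by (subst euclidean_inner) (simp add: inner_sum_left_Basis power2_eq_square)

text \<open>
  Where some factor vanishes, both sides are 0 by the convention \<open>0 ln 0 = 0\<close>.
\<close>

lemma tensor_ln_tensor:
  fixes f :: "'a::euclidean_space \<Rightarrow> real \<Rightarrow> real"
  assumes nn: "\<And>b t. b \<in> Basis \<Longrightarrow> 0 \<le> f b t"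
  shows "tensor f x * ln (tensor f x) = (\<Sum>b\<in>Basis. partial f (\<lambda>b t. f b t * ln (f b t)) b x)"
proof -
  have "(\<Sum>b\<in>Basis. partial f (\<lambda>b t. f b t * ln (f b t)) b x) = (\<Sum>b\<in>Basis. tensor f x * ln (f b (x \<bullet> b)))"
    by (intro sum.cong refl) (simp add: partial_def tensor_eq)
  also have "\<dots> = tensor f x * (\<Sum>b\<in>Basis. ln (f b (x \<bullet> b)))"
    by (simp add: sum_distrib_left)
  also have "\<dots> = tensor f x * ln (tensor f x)"
  proof (cases "\<exists>b\<in>Basis. f b (x \<bullet> b) = 0")
    case True
    then have "tensor f x = 0" by (simp add: tensor_def)
    then show ?thesis by simp
  next
    case False
    then have "f b (x \<bullet> b) > 0" if "b \<in> Basis" for b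
      using nn[OF that, of "x \<bullet> b"] that by (force simp: order.order_iff_strict)
    then have "ln (tensor f x) = (\<Sum>b\<in>Basis. ln (f b (x \<bullet> b)))"
      unfolding tensor_def by (intro ln_prod) fastforce+
    then show ?thesis by simp
  qed
  finally show ?thesis by simp
qed

lemma integral_entropy_tensor:
  fixes f :: "'a::euclidean_space \<Rightarrow> real \<Rightarrow> real"
  assumes "\<And>b t. b \<in> Basis \<Longrightarrow> 0 \<le> f b t"
    and "\<And>b. b \<in> Basis \<Longrightarrow> integrable (gaussian \<sigma>) (f b)" "\<And>b. b \<in> Basis \<Longrightarrow> (\<integral>t. f b t \<partial>gaussian \<sigma>) = 1"
    and "\<And>b. b \<in> Basis \<Longrightarrow> integrable (gaussian \<sigma>) (\<lambda>t. f b t * ln (f b t))"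
  shows "(\<integral>x. tensor f x * ln (tensor f x) \<partial>gaussian \<sigma>) = (\<Sum>b\<in>Basis. \<integral>t. f b t * ln (f b t) \<partial>gaussian \<sigma>)"
  using assms by (simp add: tensor_ln_tensor integral_sum_partial)

lemma gauss_eq_gaussian: "gauss = gaussian 1"
  unfolding gauss_def gaussian_def
proof (intro arg_cong[where f = "density lborel"] ext arg_cong[where f = ennreal])
  fix x :: 'a
  have "(1 / sqrt (2 * pi)) ^ DIM('a) = (2 * pi) powr (- (real DIM('a) / 2))"
    by (simp add: powr_half_sqrt[symmetric] powr_minus_divide power_one_over powr_realpow[symmetric] powr_powr)
  moreover have "(\<Sum>b\<in>Basis. - (x \<bullet> b)\<^sup>2 / 2) = - (norm x)\<^sup>2 / 2"
    unfolding power2_norm_eq_inner by (subst euclidean_inner) (simp add: power2_eq_square sum_negf sum_divide_distrib)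
  ultimately show "(2 * pi) powr (- (real DIM('a) / 2)) * exp (- (norm x)\<^sup>2 / 2) = tensor (\<lambda>_. normal_density 0 1) x"
    unfolding tensor_def std_normal_density_def prod.distrib by (simp only: prod_constant flip: exp_sum)
      (simp add: exp_sum[symmetric])
qed

lemma gauss_pi_eq_gaussian: "gauss_pi = gaussian (1 / sqrt (2 * pi))"
  unfolding gauss_pi_def gaussian_def
proof (intro arg_cong[where f = "density lborel"] ext arg_cong[where f = ennreal])
  fix x :: 'a
  have "normal_density 0 (1 / sqrt (2 * pi)) t = exp (- pi * t\<^sup>2)" for t
    by (simp add: normal_density_def power_divide field_simps)
  moreover have "(\<Sum>b\<in>Basis. - pi * (x \<bullet> b)\<^sup>2) = - pi * (norm x)\<^sup>2"
    unfolding power2_norm_eq_inner by (subst euclidean_inner) (simp add: power2_eq_square sum_distrib_left)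
  ultimately show "exp (- pi * (norm x)\<^sup>2) = tensor (\<lambda>_. normal_density 0 (1 / sqrt (2 * pi))) x"
    by (simp add: tensor_def exp_sum[symmetric])
qed

lemma deficit_eq:
  assumes f: "has_weak_gradient f G"
  shows "deficit f = 1 / 2 * (\<integral>x. (norm (G x))\<^sup>2 / f x \<partial>gaussian 1) - (\<integral>x. f x * ln (f x) \<partial>gaussian 1)"
proof -
  note [measurable] = borel_measurable_of_weak_gradient[OF f]
    borel_measurable_of_weak_gradient[OF has_weak_gradient_weak_gradient[OF f]]
  have "(\<integral>x. (norm (weak_gradient f x))\<^sup>2 / f x \<partial>gaussian 1) = (\<integral>x. (norm (G x))\<^sup>2 / f x \<partial>gaussian 1)"
    using weak_gradient_AE_eq[OF f]
    by (intro integral_cong_AE) (auto simp: AE_gaussian_iff)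
  then show ?thesis by (simp add: deficit_def gauss_eq_gaussian)
qed

lemma deficit_star_eq:
  assumes f: "has_weak_gradient f G"
  shows "deficit_star f = ((\<integral>x. (norm (G x))\<^sup>2 \<partial>gaussian (1 / sqrt (2 * pi)))
    - pi * (\<integral>x. (f x)\<^sup>2 * ln ((f x)\<^sup>2) \<partial>gaussian (1 / sqrt (2 * pi)))) / pi"
proof -
  note [measurable] = borel_measurable_of_weak_gradient[OF f]
    borel_measurable_of_weak_gradient[OF has_weak_gradient_weak_gradient[OF f]]
  have "(\<integral>x. (norm (weak_gradient f x))\<^sup>2 \<partial>gaussian (1 / sqrt (2 * pi))) = (\<integral>x. (norm (G x))\<^sup>2 \<partial>gaussian (1 / sqrt (2 * pi)))"
    using weak_gradient_AE_eq[OF f]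
    by (intro integral_cong_AE) (auto simp: AE_gaussian_iff)
  then show ?thesis by (simp add: deficit_star_def gauss_pi_eq_gaussian)
qed

text \<open>
  Dividing \<open>|\<nabla>F|\<^sup>2 = \<Sum>(g\<^sub>b \<Prod>f\<^sub>c)\<^sup>2\<close>, with the product over \<open>c \<noteq> b\<close>, by \<open>F = f\<^sub>b \<Prod>f\<^sub>c\<close>
  leaves \<open>\<Sum>(g\<^sub>b\<^sup>2 / f\<^sub>b) \<Prod>f\<^sub>c\<close>; with division by 0 giving 0 this also holds where \<open>F = 0\<close>. The
  integrability assumptions exclude the default value 0 of the integral.
\<close>

lemma deficit_tensor:
  fixes f :: "'a::euclidean_space \<Rightarrow> real \<Rightarrow> real"
  assumes fg: "\<And>b. b \<in> Basis \<Longrightarrow> has_weak_gradient (f b) (g b)"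
    and nn: "\<And>b t. b \<in> Basis \<Longrightarrow> 0 \<le> f b t"
    and int: "\<And>b. b \<in> Basis \<Longrightarrow> integrable (gaussian 1) (f b)" "\<And>b. b \<in> Basis \<Longrightarrow> (\<integral>t. f b t \<partial>gaussian 1) = 1"
    and ent: "\<And>b. b \<in> Basis \<Longrightarrow> integrable (gaussian 1) (\<lambda>t. f b t * ln (f b t))"
    and fisher: "\<And>b. b \<in> Basis \<Longrightarrow> integrable (gaussian 1) (\<lambda>t. (g b t)\<^sup>2 / f b t)"
  shows "deficit (tensor f) = (\<Sum>b\<in>Basis. deficit (f b))"
proof -
  have "(norm (\<Sum>b\<in>Basis. partial f g b x *\<^sub>R b))\<^sup>2 / tensor f x = (\<Sum>b\<in>Basis. partial f (\<lambda>b t. (g b t)\<^sup>2 / f b t) b x)" for x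
    unfolding norm_square_sum_Basis sum_divide_distrib
    by (intro sum.cong refl) (simp add: partial_def tensor_eq power_mult_distrib power2_eq_square)
  then have "(\<integral>x. (norm (\<Sum>b\<in>Basis. partial f g b x *\<^sub>R b))\<^sup>2 / tensor f x \<partial>gaussian 1)
      = (\<Sum>b\<in>Basis. \<integral>t. (g b t)\<^sup>2 / f b t \<partial>gaussian 1)"
    using int fisher by (simp add: integral_sum_partial)
  moreover have "(\<integral>x. tensor f x * ln (tensor f x) \<partial>gaussian 1) = (\<Sum>b\<in>Basis. \<integral>t. f b t * ln (f b t) \<partial>gaussian 1)"
    by (rule integral_entropy_tensor) (simp_all add: nn int ent)
  moreover have "deficit (tensor f) = 1 / 2 * (\<integral>x. (norm (\<Sum>b\<in>Basis. partial f g b x *\<^sub>R b))\<^sup>2 / tensor f x \<partial>gaussian 1)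
      - (\<integral>x. tensor f x * ln (tensor f x) \<partial>gaussian 1)"
    by (rule deficit_eq[OF has_weak_gradient_tensor[OF fg]])
  moreover have "(\<Sum>b\<in>Basis. deficit (f b)) = (\<Sum>b\<in>Basis. 1 / 2 * (\<integral>t. (g b t)\<^sup>2 / f b t \<partial>gaussian 1)
      - (\<integral>t. f b t * ln (f b t) \<partial>gaussian 1))"
    by (intro sum.cong refl) (simp add: deficit_eq[OF fg])
  ultimately show ?thesis
    by (simp add: sum_subtractf sum_divide_distrib)
qed

text \<open>
  As for the other deficit, with the squares \<open>u\<^sub>c\<^sup>2\<close> as the normalised densities.
\<close>

lemma deficit_star_tensor:
  fixes u :: "'a::euclidean_space \<Rightarrow> real \<Rightarrow> real"
  defines "\<sigma> \<equiv> 1 / sqrt (2 * pi)"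
  assumes ug: "\<And>b. b \<in> Basis \<Longrightarrow> has_weak_gradient (u b) (g b)"
    and int: "\<And>b. b \<in> Basis \<Longrightarrow> integrable (gaussian \<sigma>) (\<lambda>t. (u b t)\<^sup>2)" "\<And>b. b \<in> Basis \<Longrightarrow> (\<integral>t. (u b t)\<^sup>2 \<partial>gaussian \<sigma>) = 1"
    and ent: "\<And>b. b \<in> Basis \<Longrightarrow> integrable (gaussian \<sigma>) (\<lambda>t. (u b t)\<^sup>2 * ln ((u b t)\<^sup>2))"
    and energy: "\<And>b. b \<in> Basis \<Longrightarrow> integrable (gaussian \<sigma>) (\<lambda>t. (g b t)\<^sup>2)"
  shows "deficit_star (tensor u) = (\<Sum>b\<in>Basis. deficit_star (u b))"
proof -
  let ?q = "\<lambda>b t. (u b t)\<^sup>2"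
  have sq: "(tensor u x)\<^sup>2 = tensor ?q x" for x
    by (simp add: tensor_def prod_power_distrib)
  have "(norm (\<Sum>b\<in>Basis. partial u g b x *\<^sub>R b))\<^sup>2 = (\<Sum>b\<in>Basis. partial ?q (\<lambda>b t. (g b t)\<^sup>2) b x)" for x
    unfolding norm_square_sum_Basis
    by (intro sum.cong refl) (simp add: partial_def power_mult_distrib prod_power_distrib)
  then have "(\<integral>x. (norm (\<Sum>b\<in>Basis. partial u g b x *\<^sub>R b))\<^sup>2 \<partial>gaussian \<sigma>)
      = (\<Sum>b\<in>Basis. \<integral>t. (g b t)\<^sup>2 \<partial>gaussian \<sigma>)"
    using int energy by (simp add: integral_sum_partial)
  moreover have "(\<integral>x. (tensor u x)\<^sup>2 * ln ((tensor u x)\<^sup>2) \<partial>gaussian \<sigma>)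
      = (\<Sum>b\<in>Basis. \<integral>t. (u b t)\<^sup>2 * ln ((u b t)\<^sup>2) \<partial>gaussian \<sigma>)"
    unfolding sq by (rule integral_entropy_tensor) (simp_all add: int ent)
  moreover have "deficit_star (tensor u) = ((\<integral>x. (norm (\<Sum>b\<in>Basis. partial u g b x *\<^sub>R b))\<^sup>2 \<partial>gaussian \<sigma>)
      - pi * (\<integral>x. (tensor u x)\<^sup>2 * ln ((tensor u x)\<^sup>2) \<partial>gaussian \<sigma>)) / pi"
    unfolding \<sigma>_def by (rule deficit_star_eq[OF has_weak_gradient_tensor[OF ug]])
  moreover have "(\<Sum>b\<in>Basis. deficit_star (u b)) = (\<Sum>b\<in>Basis. ((\<integral>t. (g b t)\<^sup>2 \<partial>gaussian \<sigma>)
      - pi * (\<integral>t. (u b t)\<^sup>2 * ln ((u b t)\<^sup>2) \<partial>gaussian \<sigma>)) / pi)"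
    by (intro sum.cong refl) (simp add: deficit_star_eq[OF ug] \<sigma>_def)
  ultimately show ?thesis
    by (simp add: sum_subtractf sum_divide_distrib sum_distrib_left diff_divide_distrib)
qed

section \<open>Finiteness of the entropy on the line\<close>

lemma abs_mult_ln_le_1:
  fixes y :: real
  assumes "0 \<le> y" "y \<le> 1"
  shows "\<bar>y * ln y\<bar> \<le> 1"
proof (cases "y = 0")
  case False
  then have y: "y > 0" using assms by simp
  have "- ln y \<le> 1 / y - 1"
    using ln_le_minus_one[of "1 / y"] y by (simp add: ln_div)
  then have "y * (- ln y) \<le> y * (1 / y - 1)"
    using y by (intro mult_left_mono) auto
  also have "\<dots> \<le> 1" using y by (simp add: field_simps)
  finally show ?thesis
    using assms y by (simp add: abs_mult)
qed simp

lemma integrable_gaussian_iff: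
  assumes "f \<in> borel_measurable borel"
  shows "integrable (gaussian \<sigma>) f \<longleftrightarrow> integrable lborel (\<lambda>x::real. normal_density 0 \<sigma> x * f x)"
  unfolding gaussian_real using assms by (subst integrable_density) auto

lemma primitive_bounded:
  assumes p: "primitive p p'" and int: "integrable lborel p'"
  obtains C where "\<And>x. \<bar>p x\<bar> \<le> C"
proof
  have le: "\<bar>p b - p a\<bar> \<le> (\<integral>x. \<bar>p' x\<bar> \<partial>lborel)" if "a \<le> b" for a b
  proof -
    have "p b - p a = (\<integral>x. indicator {a..b} x *\<^sub>R p' x \<partial>lborel)"
      using p that by (simp add: primitive_def set_lebesgue_integral_def)
    also have "\<bar>\<dots>\<bar> \<le> (\<integral>x. \<bar>indicator {a..b} x *\<^sub>R p' x\<bar> \<partial>lborel)"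
      by (rule integral_abs_bound)
    also have "\<dots> \<le> (\<integral>x. \<bar>p' x\<bar> \<partial>lborel)"
      using int by (intro integral_mono integrable_abs integrable_mult_indicator)
        (auto split: split_indicator)
    finally show ?thesis .
  qed
  fix x
  show "\<bar>p x\<bar> \<le> \<bar>p 0\<bar> + (\<integral>x. \<bar>p' x\<bar> \<partial>lborel)"
    using le[of 0 x] le[of x 0] by (cases "0 \<le> x") linarith+
qed

lemma normal_density_primitive:
  assumes "0 < \<sigma>"
  shows "primitive (normal_density 0 \<sigma>) (\<lambda>x. - (x / \<sigma>\<^sup>2) * normal_density 0 \<sigma> x)"
proof (rule primitive_C1)
  show "(normal_density 0 \<sigma> has_real_derivative - (x / \<sigma>\<^sup>2) * normal_density 0 \<sigma> x) (at x)" for x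
    unfolding normal_density_def[abs_def] using assms
    by (auto intro!: derivative_eq_intros simp: power2_eq_square field_simps)
  show "continuous_on UNIV (\<lambda>x. - (x / \<sigma>\<^sup>2) * normal_density 0 \<sigma> x)"
    unfolding normal_density_def using assms by (intro continuous_intros) auto
qed

lemma primitive_square:
  "primitive h W \<Longrightarrow> primitive (\<lambda>x. (h x)\<^sup>2) (\<lambda>x. 2 * h x * W x)"
  using primitive_mult[of h W h W] by (simp add: power2_eq_square algebra_simps)

text \<open>
  The derivative of \<open>h\<^sup>2 \<rho>\<close> is \<open>2 h W \<rho> + h\<^sup>2 \<rho>'\<close> with \<open>\<rho>' = - x \<rho> / \<sigma>\<^sup>2\<close>. It is integrable by
  \<open>2 |h W| \<le> h\<^sup>2 + W\<^sup>2\<close> and \<open>|x| \<le> 1 + x\<^sup>2\<close>, so \<open>h\<^sup>2 \<rho>\<close> is bounded.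
\<close>

lemma gaussian_sobolev_growth:
  assumes \<sigma>: "0 < \<sigma>" and h: "primitive h W"
    and int: "integrable (gaussian \<sigma>) (\<lambda>x. (h x)\<^sup>2)" "integrable (gaussian \<sigma>) (\<lambda>x. (W x)\<^sup>2)"
      "integrable (gaussian \<sigma>) (\<lambda>x. x\<^sup>2 * (h x)\<^sup>2)"
  obtains C where "\<And>x. (h x)\<^sup>2 * normal_density 0 \<sigma> x \<le> C"
proof -
  let ?\<rho> = "normal_density 0 \<sigma>"
  have [measurable]: "h \<in> borel_measurable borel"
    by (intro borel_measurable_continuous_onI primitive_continuous[OF h])
  have [measurable]: "W \<in> borel_measurable borel"
    using h by (simp add: primitive_def locally_integrable_def)
  let ?p' = "\<lambda>x. 2 * h x * W x * ?\<rho> x + (h x)\<^sup>2 * (- (x / \<sigma>\<^sup>2) * ?\<rho> x)"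
  have p: "primitive (\<lambda>x. (h x)\<^sup>2 * ?\<rho> x) ?p'"
    by (rule primitive_mult[OF primitive_square[OF h] normal_density_primitive[OF \<sigma>]])
  let ?b = "\<lambda>x. ?\<rho> x * (h x)\<^sup>2 + ?\<rho> x * (W x)\<^sup>2 + (?\<rho> x * (h x)\<^sup>2 + ?\<rho> x * (x\<^sup>2 * (h x)\<^sup>2)) / \<sigma>\<^sup>2"
  have "integrable lborel ?b"
    using int by (simp add: integrable_gaussian_iff)
  then have "integrable lborel ?p'"
  proof (rule Bochner_Integration.integrable_bound)
    show "AE x in lborel. norm (?p' x) \<le> norm (?b x)"
    proof (intro AE_I2)
      fix x
      have 1: "\<bar>2 * h x * W x\<bar> \<le> (h x)\<^sup>2 + (W x)\<^sup>2"
        using sum_squares_bound[of "\<bar>h x\<bar>" "\<bar>W x\<bar>"] by (simp add: abs_mult)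
      have 2: "\<bar>x\<bar> \<le> 1 + x\<^sup>2"
        using sum_squares_bound[of 1 "\<bar>x\<bar>"] by simp
      have "norm (?p' x) \<le> \<bar>2 * h x * W x\<bar> * ?\<rho> x + (h x)\<^sup>2 * (\<bar>x\<bar> / \<sigma>\<^sup>2 * ?\<rho> x)"
        by (rule order_trans[OF norm_triangle_ineq]) (simp add: abs_mult)
      also have "\<dots> \<le> ((h x)\<^sup>2 + (W x)\<^sup>2) * ?\<rho> x + (h x)\<^sup>2 * ((1 + x\<^sup>2) / \<sigma>\<^sup>2 * ?\<rho> x)"
        by (intro add_mono mult_right_mono mult_left_mono divide_right_mono 1 2) auto
      also have "\<dots> = ?b x" using \<sigma> by (simp add: field_simps)
      also have "\<dots> \<le> norm (?b x)" by simp
      finally show "norm (?p' x) \<le> norm (?b x)" .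
    qed
  qed measurable
  then obtain C where "\<And>x. \<bar>(h x)\<^sup>2 * ?\<rho> x\<bar> \<le> C"
    by (rule primitive_bounded[OF p]) blast
  then show thesis by (intro that[of C]) (metis abs_le_D1)
qed

text \<open>
  By the growth bound \<open>w\<^sup>2 \<le> C / \<rho>\<close>, the logarithm of \<open>w\<^sup>2\<close> is at most a constant plus
  \<open>x\<^sup>2 / (2 \<sigma>\<^sup>2)\<close>; so the second moment dominates the entropy where \<open>w\<^sup>2 > 1\<close>. Where \<open>w\<^sup>2 \<le> 1\<close>
  the integrand is bounded.
\<close>

lemma integrable_entropy:
  fixes w :: "real \<Rightarrow> real"
  assumes \<sigma>: "0 < \<sigma>" and w: "has_weak_gradient w W"
    and int: "integrable (gaussian \<sigma>) (\<lambda>x. (w x)\<^sup>2)" "integrable (gaussian \<sigma>) (\<lambda>x. (W x)\<^sup>2)"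
      "integrable (gaussian \<sigma>) (\<lambda>x. x\<^sup>2 * (w x)\<^sup>2)"
  shows "integrable (gaussian \<sigma>) (\<lambda>x. (w x)\<^sup>2 * ln ((w x)\<^sup>2))"
proof -
  let ?\<rho> = "normal_density 0 \<sigma>"
  interpret prob_space "gaussian \<sigma> :: real measure" by (rule prob_space_gaussian_real[OF \<sigma>])
  have wm[measurable]: "w \<in> borel_measurable borel"
    using w by (rule borel_measurable_of_weak_gradient)
  obtain h where h: "primitive h W" and wh: "AE x in lborel. w x = h x"
    using w by (rule weak_gradient_imp_primitive)
  have hm[measurable]: "h \<in> borel_measurable borel"
    using h by (intro borel_measurable_continuous_onI primitive_continuous)
  have ae: "AE x in gaussian \<sigma>. w x = h x"
    using wh by (simp add: AE_gaussian_iff[OF \<sigma>])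
  have "integrable (gaussian \<sigma>) (\<lambda>x. (h x)\<^sup>2)"
    by (rule integrable_cong_AE_imp[OF int(1)]) (measurable, use ae in \<open>eventually_elim, simp\<close>)
  moreover have "integrable (gaussian \<sigma>) (\<lambda>x. x\<^sup>2 * (h x)\<^sup>2)"
    by (rule integrable_cong_AE_imp[OF int(3)]) (measurable, use ae in \<open>eventually_elim, simp\<close>)
  ultimately obtain C where C: "\<And>x. (h x)\<^sup>2 * ?\<rho> x \<le> C"
    using gaussian_sobolev_growth[OF \<sigma> h _ int(2)] by blast
  \<comment> \<open>The added 1 makes \<open>ln D\<close> nonnegative.\<close>
  define D where "D = \<bar>C\<bar> * sqrt (2 * pi * \<sigma>\<^sup>2) + 1"
  have D: "D \<ge> 1" by (simp add: D_def)
  have ln_h: "ln ((h x)\<^sup>2) \<le> ln D + x\<^sup>2 / (2 * \<sigma>\<^sup>2)" if "h x \<noteq> 0" for x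
  proof -
    have s: "sqrt (2 * pi * \<sigma>\<^sup>2) > 0" using \<sigma> by simp
    have "(h x)\<^sup>2 = (h x)\<^sup>2 * ?\<rho> x * (sqrt (2 * pi * \<sigma>\<^sup>2) * exp (x\<^sup>2 / (2 * \<sigma>\<^sup>2)))"
      using s \<sigma> by (simp add: normal_density_def exp_minus field_simps)
    also have "\<dots> \<le> \<bar>C\<bar> * (sqrt (2 * pi * \<sigma>\<^sup>2) * exp (x\<^sup>2 / (2 * \<sigma>\<^sup>2)))"
      using C[of x] s by (intro mult_right_mono) auto
    also have "\<dots> \<le> D * exp (x\<^sup>2 / (2 * \<sigma>\<^sup>2))"
      by (simp add: D_def algebra_simps)
    finally have "ln ((h x)\<^sup>2) \<le> ln (D * exp (x\<^sup>2 / (2 * \<sigma>\<^sup>2)))"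
      using that by (subst ln_le_cancel_iff) (use D in auto)
    also have "\<dots> = ln D + x\<^sup>2 / (2 * \<sigma>\<^sup>2)"
      using D by (simp add: ln_mult)
    finally show ?thesis .
  qed
  \<comment> \<open>The summand 1 dominates the region \<open>w\<^sup>2 \<le> 1\<close>, the rest the region \<open>w\<^sup>2 > 1\<close>.\<close>
  let ?b = "\<lambda>x. 1 + (ln D * (w x)\<^sup>2 + (x\<^sup>2 * (w x)\<^sup>2) / (2 * \<sigma>\<^sup>2))"
  have "integrable (gaussian \<sigma>) ?b"
    using int by simp
  then show ?thesis
  proof (rule Bochner_Integration.integrable_bound)
    show "AE x in gaussian \<sigma>. norm ((w x)\<^sup>2 * ln ((w x)\<^sup>2)) \<le> norm (?b x)"
      using ae
    proof eventually_elim
      case (elim x)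
      let ?y = "(h x)\<^sup>2"
      have nn: "0 \<le> ln D * ?y" "0 \<le> (x\<^sup>2 * ?y) / (2 * \<sigma>\<^sup>2)" using D by auto
      show ?case
      proof (cases "?y \<le> 1")
        case True
        then show ?thesis unfolding elim real_norm_def using abs_mult_ln_le_1[OF zero_le_power2 True] nn by linarith
      next
        case False
        then have "h x \<noteq> 0" "0 \<le> ln ?y" by auto
        then have "\<bar>?y * ln ?y\<bar> \<le> ?y * (ln D + x\<^sup>2 / (2 * \<sigma>\<^sup>2))"
          using ln_h[of x] by (simp add: abs_mult mult_left_mono)
        also have "\<dots> = ln D * ?y + (x\<^sup>2 * ?y) / (2 * \<sigma>\<^sup>2)"
          by (simp add: algebra_simps)
        finally show ?thesis unfolding elim real_norm_def using nn by linarith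
      qed
    qed
  qed measurable
qed

text \<open>
  The chain rule is the product rule for the continuous representative.
\<close>

lemma has_weak_gradient_square:
  fixes w :: "real \<Rightarrow> real"
  assumes w: "has_weak_gradient w W"
  shows "has_weak_gradient (\<lambda>x. (w x)\<^sup>2) (\<lambda>x. 2 * w x * W x)"
proof -
  note [measurable] = borel_measurable_of_weak_gradient[OF w]
  obtain h where h: "primitive h W" and wh: "AE x in lborel. w x = h x"
    using w by (rule weak_gradient_imp_primitive)
  show ?thesis
    by (rule has_weak_gradient_AE_eq[OF primitive_imp_weak_gradient[OF primitive_square[OF h]]])
      (use wh in \<open>eventually_elim, simp\<close>, use wh in \<open>eventually_elim, simp\<close>, measurable)
qed

lemma integrable_second_moment:
  assumes [measurable]: "q \<in> borel_measurable borel" and "\<And>x. 0 \<le> q x"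
    and "centered_density (gaussian \<sigma>) \<alpha> q"
  shows "integrable (gaussian \<sigma>) (\<lambda>x. x\<^sup>2 * q x)"
proof (rule integrableI_bounded)
  have "(\<integral>\<^sup>+x. ennreal (norm (x\<^sup>2 * q x)) \<partial>gaussian \<sigma>) \<le> ennreal \<alpha>"
    using assms by (simp add: centered_density_def)
  then show "(\<integral>\<^sup>+x. ennreal (norm (x\<^sup>2 * q x)) \<partial>gaussian \<sigma>) < \<infinity>"
    using order_le_less_trans by fastforce
qed measurable

section \<open>Power means and nonnegative deficits\<close>

text \<open>
  The Cauchy-Schwarz inequality, applied twice.
\<close>

lemma sum_power4_le:
  fixes r :: "'i \<Rightarrow> real"
  shows "(\<Sum>i\<in>I. r i) ^ 4 \<le> real (card I) ^ 3 * (\<Sum>i\<in>I. r i ^ 4)"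
proof -
  have "(\<Sum>i\<in>I. r i) ^ 4 = ((\<Sum>i\<in>I. r i)\<^sup>2)\<^sup>2" by simp
  also have "\<dots> \<le> ((\<Sum>i\<in>I. (r i)\<^sup>2) * card I)\<^sup>2"
    by (intro power_mono sum_squared_le_sum_of_squares) simp
  also have "\<dots> = (\<Sum>i\<in>I. (r i)\<^sup>2)\<^sup>2 * (real (card I))\<^sup>2" by (simp add: power_mult_distrib)
  also have "\<dots> \<le> (\<Sum>i\<in>I. ((r i)\<^sup>2)\<^sup>2) * card I * (real (card I))\<^sup>2"
    by (intro mult_right_mono sum_squared_le_sum_of_squares) simp
  also have "\<dots> = real (card I) ^ 3 * (\<Sum>i\<in>I. r i ^ 4)"
    by (simp add: power2_eq_square power3_eq_cube power4_eq_xxxx mult_ac)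
  finally show ?thesis .
qed

lemma sum_root4_le:
  assumes d: "\<And>i. i \<in> I \<Longrightarrow> 0 \<le> d i"
  shows "(\<Sum>i\<in>I. root 4 (d i)) \<le> real (card I) powr (3 / 4) * root 4 (\<Sum>i\<in>I. d i)"
proof -
  have "(\<Sum>i\<in>I. root 4 (d i)) ^ 4 \<le> real (card I) ^ 3 * (\<Sum>i\<in>I. root 4 (d i) ^ 4)"
    by (rule sum_power4_le)
  also have "(\<Sum>i\<in>I. root 4 (d i) ^ 4) = (\<Sum>i\<in>I. d i)"
    using d by (intro sum.cong) auto
  finally have "root 4 ((\<Sum>i\<in>I. root 4 (d i)) ^ 4) \<le> root 4 (real (card I) ^ 3 * (\<Sum>i\<in>I. d i))"
    by simp
  moreover have "root 4 ((\<Sum>i\<in>I. root 4 (d i)) ^ 4) = (\<Sum>i\<in>I. root 4 (d i))"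
    using d by (intro real_root_power_cancel) (auto intro!: sum_nonneg)
  moreover have "root 4 (real (card I) ^ 3) = real (card I) powr (3 / 4)"
  proof (cases "card I = 0")
    case False
    then have "real (card I) ^ 3 = real (card I) powr 3" by (simp add: powr_numeral)
    then have "root 4 (real (card I) ^ 3) = root 4 (real (card I) powr 3)" by (simp only:)
    also have "\<dots> = (real (card I) powr 3) powr (1 / real 4)"
      using False by (intro root_powr_inverse) auto
    also have "\<dots> = real (card I) powr (3 / 4)" by (simp only: powr_powr) simp
    finally show ?thesis .
  qed simp
  ultimately show ?thesis by (simp add: real_root_mult)
qed

text \<open>
  The preceding bound for \<open>d\<^sup>3\<close>, together with \<open>\<Sum>d\<^sub>i\<^sup>3 \<le> (\<Sum>d\<^sub>i)\<^sup>3\<close>.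
\<close>

lemma sum_root4_cube_le:
  assumes d: "\<And>i. i \<in> I \<Longrightarrow> 0 \<le> d i" and I: "finite I"
  shows "(\<Sum>i\<in>I. root 4 (d i) ^ 3) \<le> real (card I) powr (3 / 4) * root 4 (\<Sum>i\<in>I. d i) ^ 3"
proof -
  have "(\<Sum>i\<in>I. root 4 (d i) ^ 3) = (\<Sum>i\<in>I. root 4 (d i ^ 3))"
    by (simp add: real_root_power)
  also have "\<dots> \<le> real (card I) powr (3 / 4) * root 4 (\<Sum>i\<in>I. d i ^ 3)"
    by (rule sum_root4_le) (simp add: d)
  also have "(\<Sum>i\<in>I. d i ^ 3) \<le> (\<Sum>i\<in>I. d i * (\<Sum>i\<in>I. d i)\<^sup>2)"
  proof (rule sum_mono)
    fix i assume i: "i \<in> I"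
    have "(d i)\<^sup>2 \<le> (\<Sum>i\<in>I. d i)\<^sup>2"
      using d i I by (intro power_mono member_le_sum) auto
    from mult_left_mono[OF this d[OF i]] show "d i ^ 3 \<le> d i * (\<Sum>i\<in>I. d i)\<^sup>2"
      by (simp add: power3_eq_cube power2_eq_square mult_ac)
  qed
  also have "\<dots> = (\<Sum>i\<in>I. d i) ^ 3"
    by (simp add: power3_eq_cube power2_eq_square flip: sum_distrib_right)
  finally show ?thesis
    by (simp add: real_root_power mult_left_mono)
qed

lemma W11_norm_zero:
  fixes g :: "'a::euclidean_space \<Rightarrow> real"
  assumes \<sigma>: "0 < \<sigma>" and g: "has_weak_gradient g G" and 0: "W11_norm (gaussian \<sigma>) (\<lambda>x. g x - 1) = 0"
  shows "AE x in gaussian \<sigma>. g x = 1" "AE x in gaussian \<sigma>. G x = 0"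
proof -
  note [measurable] = borel_measurable_of_weak_gradient[OF g]
  have "(\<integral>\<^sup>+x. ennreal \<bar>g x - 1\<bar> \<partial>gaussian \<sigma>) = 0" "(\<integral>\<^sup>+x. ennreal (norm (G x)) \<partial>gaussian \<sigma>) = 0"
    using 0 unfolding W11_norm_minus_1[OF \<sigma> g] by auto
  then show "AE x in gaussian \<sigma>. g x = 1" "AE x in gaussian \<sigma>. G x = 0"
    by (simp_all add: nn_integral_0_iff_AE)
qed

text \<open>
  The fourth root of a negative number is taken to be negative. Hence a negative deficit would make
  the bound nonpositive and force \<open>f = 1\<close> with gradient 0 almost everywhere; but then the deficit
  is 0. This takes the place of the logarithmic Sobolev inequality.
\<close>

lemma deficit_nonneg_of_W11_bound:
  fixes f :: "'a::euclidean_space \<Rightarrow> real"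
  assumes f: "has_weak_gradient f G" and a: "0 < a"
    and le: "W11_norm gauss (\<lambda>x. f x - 1) \<le> ennreal (a * (root 4 (deficit f) + root 4 (deficit f) ^ 3))"
  shows "0 \<le> deficit f"
proof (rule ccontr)
  note [measurable] = borel_measurable_of_weak_gradient[OF f]
  assume neg: "\<not> 0 \<le> deficit f"
  then have r: "root 4 (deficit f) < 0" by simp
  then have "root 4 (deficit f) ^ 3 < 0" using power_less_zero_eq[of "root 4 (deficit f)" 3] by simp
  then have "a * (root 4 (deficit f) + root 4 (deficit f) ^ 3) \<le> 0"
    by (intro less_imp_le mult_pos_neg add_neg_neg r a)
  with le have "W11_norm (gaussian 1) (\<lambda>x. f x - 1) = 0"
    by (simp add: gauss_eq_gaussian ennreal_neg)
  note ae = W11_norm_zero[OF _ f this]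
  have "(\<integral>x. (norm (G x))\<^sup>2 / f x \<partial>gaussian 1) = 0"
    by (rule integral_eq_zero_AE) (use ae(2) in auto)
  moreover have "(\<integral>x. f x * ln (f x) \<partial>gaussian 1) = 0"
    by (rule integral_eq_zero_AE) (use ae(1) in auto)
  ultimately show False using neg by (simp add: deficit_eq[OF f])
qed

lemma deficit_star_nonneg_of_W11_bound:
  fixes u :: "'a::euclidean_space \<Rightarrow> real"
  assumes u: "has_weak_gradient u G" and a: "0 < a"
    and le: "W11_norm gauss_pi (\<lambda>x. u x - 1) \<le> ennreal (a * (root 4 (deficit_star u) + deficit_star u))"
  shows "0 \<le> deficit_star u"
proof (rule ccontr)
  note [measurable] = borel_measurable_of_weak_gradient[OF u]
  assume neg: "\<not> 0 \<le> deficit_star u"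
  then have "root 4 (deficit_star u) < 0" "deficit_star u < 0" by simp_all
  then have "a * (root 4 (deficit_star u) + deficit_star u) \<le> 0"
    by (intro less_imp_le mult_pos_neg add_neg_neg a)
  with le have "W11_norm (gaussian (1 / sqrt (2 * pi))) (\<lambda>x. u x - 1) = 0"
    by (simp add: gauss_pi_eq_gaussian ennreal_neg)
  note ae = W11_norm_zero[OF _ u this]
  have "(\<integral>x. (norm (G x))\<^sup>2 \<partial>gaussian (1 / sqrt (2 * pi))) = 0"
    by (rule integral_eq_zero_AE) (use ae(2) in auto)
  moreover have "(\<integral>x. (u x)\<^sup>2 * ln ((u x)\<^sup>2) \<partial>gaussian (1 / sqrt (2 * pi))) = 0"
    by (rule integral_eq_zero_AE) (use ae(1) in auto)
  ultimately show False using neg by (simp add: deficit_star_eq[OF u])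
qed

section \<open>Products of functions in the two classes\<close>

lemma W12_centered_density:
  fixes w :: "real \<Rightarrow> real"
  assumes \<sigma>: "0 < \<sigma>" and w: "in_W12 (gaussian \<sigma>) w" and q: "centered_density (gaussian \<sigma>) \<alpha> (\<lambda>x. (w x)\<^sup>2)"
  shows "has_weak_gradient w (weak_gradient w)"
    and "integrable (gaussian \<sigma>) (\<lambda>x. (w x)\<^sup>2)" "(\<integral>x. (w x)\<^sup>2 \<partial>gaussian \<sigma>) = 1"
    and "integrable (gaussian \<sigma>) (\<lambda>x. (weak_gradient w x)\<^sup>2)"
    and "integrable (gaussian \<sigma>) (\<lambda>x. (w x)\<^sup>2 * ln ((w x)\<^sup>2))"
proof -
  show g: "has_weak_gradient w (weak_gradient w)"
    using w has_weak_gradient_weak_gradient by (auto simp: in_W12_def weakly_differentiable_def)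
  show i: "integrable (gaussian \<sigma>) (\<lambda>x. (w x)\<^sup>2)" "integrable (gaussian \<sigma>) (\<lambda>x. (weak_gradient w x)\<^sup>2)"
    using w by (simp_all add: in_W12_def)
  show "(\<integral>x. (w x)\<^sup>2 \<partial>gaussian \<sigma>) = 1"
    using q by (simp add: centered_density_def)
  have [measurable]: "w \<in> borel_measurable borel"
    using g by (rule borel_measurable_of_weak_gradient)
  show "integrable (gaussian \<sigma>) (\<lambda>x. (w x)\<^sup>2 * ln ((w x)\<^sup>2))"
    by (rule integrable_entropy[OF \<sigma> g i integrable_second_moment[OF _ _ q]]) auto
qed

text \<open>
  If \<open>W\<close> is the derivative of \<open>w = sqrt f\<close>, then \<open>f = w\<^sup>2\<close> has derivative \<open>2 w W\<close>, and \<open>(2 w W)\<^sup>2 / f \<le> 4 W\<^sup>2\<close>, with equality where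
  \<open>f \<noteq> 0\<close>.
\<close>

lemma class_f_gaussian:
  fixes f :: "real \<Rightarrow> real"
  assumes "class_f \<alpha> f"
  obtains g where "has_weak_gradient f g" "\<And>x. 0 \<le> f x"
    "integrable (gaussian 1) f" "(\<integral>x. f x \<partial>gaussian 1) = 1"
    "integrable (gaussian 1) (\<lambda>x. f x * ln (f x))" "integrable (gaussian 1) (\<lambda>x. (g x)\<^sup>2 / f x)"
proof -
  let ?w = "\<lambda>x. sqrt (f x)" let ?W = "weak_gradient ?w"
  have nn: "0 \<le> f x" for x using assms by (simp add: class_f_def)
  have "in_W12 (gaussian 1) ?w" "centered_density (gaussian 1) \<alpha> (\<lambda>x. (?w x)\<^sup>2)"
    using assms nn by (simp_all add: class_f_def gauss_eq_gaussian)
  note w = W12_centered_density[OF _ this, simplified]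
  have g: "has_weak_gradient f (\<lambda>x. 2 * ?w x * ?W x)"
    using has_weak_gradient_square[OF w(1)] nn by simp
  note [measurable] = borel_measurable_of_weak_gradient[OF w(1)] borel_measurable_of_weak_gradient[OF g]
  have "integrable (gaussian 1) (\<lambda>x. (2 * ?w x * ?W x)\<^sup>2 / f x)"
  proof (rule Bochner_Integration.integrable_bound)
    show "integrable (gaussian 1) (\<lambda>x. 4 * (?W x)\<^sup>2)" using w(4) by simp
    show "AE x in gaussian 1. norm ((2 * ?w x * ?W x)\<^sup>2 / f x) \<le> norm (4 * (?W x)\<^sup>2)"
      using nn by (intro AE_I2) (simp add: power_mult_distrib)
  qed measurable
  with g nn w show thesis by (intro that[of "\<lambda>x. 2 * ?w x * ?W x"]) simp_all
qed

lemma class_u_gaussian: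
  fixes u :: "real \<Rightarrow> real"
  defines "\<sigma> \<equiv> 1 / sqrt (2 * pi)"
  assumes "class_u \<alpha> u"
  obtains g where "has_weak_gradient u g" "\<And>x. 0 \<le> u x"
    "integrable (gaussian \<sigma>) (\<lambda>x. (u x)\<^sup>2)" "(\<integral>x. (u x)\<^sup>2 \<partial>gaussian \<sigma>) = 1"
    "integrable (gaussian \<sigma>) (\<lambda>x. (u x)\<^sup>2 * ln ((u x)\<^sup>2))" "integrable (gaussian \<sigma>) (\<lambda>x. (g x)\<^sup>2)"
proof -
  have \<sigma>: "0 < \<sigma>" by (simp add: \<sigma>_def)
  have "in_W12 (gaussian \<sigma>) u" "centered_density (gaussian \<sigma>) \<alpha> (\<lambda>x. (u x)\<^sup>2)" "\<And>x. 0 \<le> u x"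
    using assms by (simp_all add: class_u_def gauss_pi_eq_gaussian)
  with W12_centered_density[OF \<sigma> this(1,2)] show thesis by (intro that[of "weak_gradient u"]) auto
qed

text \<open>
  The standard basis vectors of \<open>real ^ 'n\<close> are indexed by \<open>'n\<close>, so factors indexed by coordinates
  become factors indexed by \<open>Basis\<close>.
\<close>

lemma product_as_tensor:
  fixes f :: "'n::finite \<Rightarrow> real \<Rightarrow> real"
  obtains h :: "real ^ 'n \<Rightarrow> real \<Rightarrow> real" where
    "(\<lambda>x::real^'n. \<Prod>k\<in>UNIV. f k (x $ k)) = tensor h" "\<And>b. b \<in> Basis \<Longrightarrow> h b \<in> range f"
proof
  let ?e = "\<lambda>k::'n. axis k (1::real)"
  have inj: "inj ?e" by (simp add: inj_on_def axis_eq_axis)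
  have B: "range ?e = Basis" by (auto simp: Basis_vec_def)
  let ?h = "\<lambda>b. f (inv ?e b)"
  show "?h b \<in> range f" for b by simp
  show "(\<lambda>x. \<Prod>k\<in>UNIV. f k (x $ k)) = tensor ?h"
    unfolding tensor_def[abs_def] B[symmetric] prod.reindex[OF inj] comp_def inv_f_f[OF inj]
    by (simp add: inner_axis)
qed

text \<open>
  By \<open>2 u \<le> 1 + u\<^sup>2\<close>.
\<close>

lemma (in prob_space) nn_integral_le_1_of_square:
  assumes [measurable]: "u \<in> borel_measurable M" and "\<And>x. 0 \<le> u x"
    and int: "integrable M (\<lambda>x. (u x)\<^sup>2)" "(\<integral>x. (u x)\<^sup>2 \<partial>M) = 1"
  shows "(\<integral>\<^sup>+x. ennreal (u x) \<partial>M) \<le> 1"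
proof -
  have "(\<integral>\<^sup>+x. ennreal (u x) \<partial>M) \<le> (\<integral>\<^sup>+x. ennreal ((1 + (u x)\<^sup>2) / 2) \<partial>M)"
    using sum_squares_bound[of 1] by (intro nn_integral_mono ennreal_leI) (simp add: field_simps)
  also have "\<dots> = ennreal (\<integral>x. (1 + (u x)\<^sup>2) / 2 \<partial>M)"
    using int by (intro nn_integral_eq_integral) auto
  also have "(\<integral>x. (1 + (u x)\<^sup>2) / 2 \<partial>M) = 1"
    using int by (simp add: prob_space)
  finally show ?thesis by simp
qed

lemma W11_product_f:
  fixes f :: "'a::euclidean_space \<Rightarrow> real \<Rightarrow> real"
  assumes a: "0 < a"
    and bound: "\<And>g. class_f \<alpha> g \<Longrightarrow>
      W11_norm gauss (\<lambda>x. g x - 1) \<le> ennreal (a * (root 4 (deficit g) + root 4 (deficit g) ^ 3))"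
    and f: "\<And>b. b \<in> Basis \<Longrightarrow> class_f \<alpha> (f b)"
  shows "W11_norm gauss (\<lambda>x. tensor f x - 1) \<le> ennreal (a * real DIM('a) powr (3 / 4) *
    (root 4 (deficit (tensor f)) + root 4 (deficit (tensor f)) ^ 3))"
proof -
  have "\<forall>b\<in>Basis. \<exists>g. has_weak_gradient (f b) g \<and> (\<forall>x. 0 \<le> f b x) \<and>
    integrable (gaussian 1) (f b) \<and> (\<integral>x. f b x \<partial>gaussian 1) = 1 \<and>
    integrable (gaussian 1) (\<lambda>x. f b x * ln (f b x)) \<and> integrable (gaussian 1) (\<lambda>x. (g x)\<^sup>2 / f b x)"
    (is "\<forall>b\<in>Basis. ?P b")
  proof
    fix b :: 'a assume "b \<in> Basis"
    show "?P b" by (rule class_f_gaussian[OF f[OF \<open>b \<in> Basis\<close>]]) blast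
  qed
  from bchoice[OF this] obtain g where g: "\<And>b. b \<in> Basis \<Longrightarrow> has_weak_gradient (f b) (g b)" "\<And>b x. b \<in> Basis \<Longrightarrow> 0 \<le> f b x"
    "\<And>b. b \<in> Basis \<Longrightarrow> integrable (gaussian 1) (f b)" "\<And>b. b \<in> Basis \<Longrightarrow> (\<integral>x. f b x \<partial>gaussian 1) = 1"
    "\<And>b. b \<in> Basis \<Longrightarrow> integrable (gaussian 1) (\<lambda>x. f b x * ln (f b x))"
    "\<And>b. b \<in> Basis \<Longrightarrow> integrable (gaussian 1) (\<lambda>x. (g b x)\<^sup>2 / f b x)"
    by blast
  let ?d = "\<lambda>b. deficit (f b)"
  have d: "0 \<le> ?d b" if "b \<in> Basis" for b
    by (rule deficit_nonneg_of_W11_bound[OF g(1)[OF that] a bound[OF f[OF that]]])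
  have D: "deficit (tensor f) = (\<Sum>b\<in>Basis. ?d b)"
    using g by (intro deficit_tensor) auto
  have "W11_norm gauss (\<lambda>x. tensor f x - 1) \<le> (\<Sum>b\<in>Basis. W11_norm gauss (\<lambda>t. f b t - 1))"
    unfolding gauss_eq_gaussian
  proof (rule W11_norm_tensor_minus_1[OF _ g(1,2)])
    show "(\<integral>\<^sup>+t. ennreal (f b t) \<partial>gaussian 1) \<le> 1" if "b \<in> Basis" for b
      using g(2-4)[OF that] by (subst nn_integral_eq_integral) auto
  qed auto
  also have "\<dots> \<le> (\<Sum>b\<in>Basis. ennreal (a * (root 4 (?d b) + root 4 (?d b) ^ 3)))"
    by (intro sum_mono bound f)
  also have "\<dots> = ennreal (\<Sum>b\<in>Basis. a * (root 4 (?d b) + root 4 (?d b) ^ 3))"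
    using a d by (intro sum_ennreal) auto
  also have "\<dots> \<le> ennreal (a * real DIM('a) powr (3 / 4) *
    (root 4 (deficit (tensor f)) + root 4 (deficit (tensor f)) ^ 3))"
  proof (rule ennreal_leI)
    have "(\<Sum>b\<in>Basis. root 4 (?d b)) + (\<Sum>b\<in>Basis. root 4 (?d b) ^ 3)
      \<le> real DIM('a) powr (3 / 4) * root 4 (\<Sum>b\<in>Basis. ?d b) + real DIM('a) powr (3 / 4) * root 4 (\<Sum>b\<in>Basis. ?d b) ^ 3"
      using d by (intro add_mono sum_root4_le sum_root4_cube_le) auto
    from mult_left_mono[OF this, of a] a
    show "(\<Sum>b\<in>Basis. a * (root 4 (?d b) + root 4 (?d b) ^ 3)) \<le> a * real DIM('a) powr (3 / 4) *
      (root 4 (deficit (tensor f)) + root 4 (deficit (tensor f)) ^ 3)"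
      unfolding D by (simp add: sum.distrib sum_distrib_left distrib_left mult.assoc)
  qed
  finally show ?thesis .
qed

lemma W11_product_u:
  fixes u :: "'a::euclidean_space \<Rightarrow> real \<Rightarrow> real"
  assumes a: "0 < a"
    and bound: "\<And>v. class_u \<alpha> v \<Longrightarrow>
      W11_norm gauss_pi (\<lambda>x. v x - 1) \<le> ennreal (a * (root 4 (deficit_star v) + deficit_star v))"
    and u: "\<And>b. b \<in> Basis \<Longrightarrow> class_u \<alpha> (u b)"
  shows "W11_norm gauss_pi (\<lambda>x. tensor u x - 1) \<le> ennreal (real DIM('a) * a *
    (root 4 (deficit_star (tensor u)) + deficit_star (tensor u)))"
proof -
  define \<sigma> where "\<sigma> = 1 / sqrt (2 * pi)"
  have \<sigma>: "0 < \<sigma>" by (simp add: \<sigma>_def)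
  interpret prob_space "gaussian \<sigma> :: real measure" by (rule prob_space_gaussian_real[OF \<sigma>])
  have "\<forall>b\<in>Basis. \<exists>g. has_weak_gradient (u b) g \<and> (\<forall>x. 0 \<le> u b x) \<and>
    integrable (gaussian \<sigma>) (\<lambda>x. (u b x)\<^sup>2) \<and> (\<integral>x. (u b x)\<^sup>2 \<partial>gaussian \<sigma>) = 1 \<and>
    integrable (gaussian \<sigma>) (\<lambda>x. (u b x)\<^sup>2 * ln ((u b x)\<^sup>2)) \<and> integrable (gaussian \<sigma>) (\<lambda>x. (g x)\<^sup>2)"
    (is "\<forall>b\<in>Basis. ?P b")
  proof
    fix b :: 'a assume "b \<in> Basis"
    show "?P b" by (rule class_u_gaussian[OF u[OF \<open>b \<in> Basis\<close>], folded \<sigma>_def]) blast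
  qed
  from bchoice[OF this] obtain g where g: "\<And>b. b \<in> Basis \<Longrightarrow> has_weak_gradient (u b) (g b)" "\<And>b x. b \<in> Basis \<Longrightarrow> 0 \<le> u b x"
    "\<And>b. b \<in> Basis \<Longrightarrow> integrable (gaussian \<sigma>) (\<lambda>x. (u b x)\<^sup>2)" "\<And>b. b \<in> Basis \<Longrightarrow> (\<integral>x. (u b x)\<^sup>2 \<partial>gaussian \<sigma>) = 1"
    "\<And>b. b \<in> Basis \<Longrightarrow> integrable (gaussian \<sigma>) (\<lambda>x. (u b x)\<^sup>2 * ln ((u b x)\<^sup>2))"
    "\<And>b. b \<in> Basis \<Longrightarrow> integrable (gaussian \<sigma>) (\<lambda>x. (g b x)\<^sup>2)"
    by blast
  let ?d = "\<lambda>b. deficit_star (u b)"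
  have d: "0 \<le> ?d b" if "b \<in> Basis" for b
    by (rule deficit_star_nonneg_of_W11_bound[OF g(1)[OF that] a bound[OF u[OF that]]])
  have D: "deficit_star (tensor u) = (\<Sum>b\<in>Basis. ?d b)"
    using g unfolding \<sigma>_def by (intro deficit_star_tensor) auto
  have "W11_norm gauss_pi (\<lambda>x. tensor u x - 1) \<le> (\<Sum>b\<in>Basis. W11_norm gauss_pi (\<lambda>t. u b t - 1))"
    unfolding gauss_pi_eq_gaussian \<sigma>_def[symmetric]
  proof (rule W11_norm_tensor_minus_1[OF \<sigma> g(1,2)])
    show "(\<integral>\<^sup>+t. ennreal (u b t) \<partial>gaussian \<sigma>) \<le> 1" if "b \<in> Basis" for b
      using g(2-4)[OF that] borel_measurable_of_weak_gradient(1)[OF g(1)[OF that]]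
      by (intro nn_integral_le_1_of_square) auto
  qed auto
  also have "\<dots> \<le> (\<Sum>b\<in>Basis. ennreal (a * (root 4 (?d b) + ?d b)))"
    by (intro sum_mono bound u)
  also have "\<dots> = ennreal (\<Sum>b\<in>Basis. a * (root 4 (?d b) + ?d b))"
    using a d by (intro sum_ennreal) auto
  also have "\<dots> \<le> ennreal (real DIM('a) * a * (root 4 (deficit_star (tensor u)) + deficit_star (tensor u)))"
  proof (rule ennreal_leI)
    have "root 4 (?d b) + ?d b \<le> root 4 (\<Sum>b\<in>Basis. ?d b) + (\<Sum>b\<in>Basis. ?d b)" if "b \<in> Basis" for b
      using d that member_le_sum[of b Basis ?d] by (intro add_mono) auto
    then have "(\<Sum>b\<in>Basis. a * (root 4 (?d b) + ?d b))
        \<le> (\<Sum>b\<in>(Basis::'a set). a * (root 4 (\<Sum>b\<in>Basis. ?d b) + (\<Sum>b\<in>Basis. ?d b)))"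
      using a by (intro sum_mono mult_left_mono) auto
    then show "(\<Sum>b\<in>Basis. a * (root 4 (?d b) + ?d b)) \<le> real DIM('a) * a *
        (root 4 (deficit_star (tensor u)) + deficit_star (tensor u))"
      unfolding D by simp
  qed
  finally show ?thesis .
qed

theorem corollary1p2:
  fixes \<alpha> :: real
  assumes "0 < \<alpha>"
  shows
    "(\<forall>a>0.
        (\<forall>g. class_f \<alpha> g \<longrightarrow>
           W11_norm gauss (\<lambda>x. g x - 1)
             \<le> ennreal (a * (root 4 (deficit g) + root 4 (deficit g) ^ 3))) \<longrightarrow>
        (\<forall>f :: 'n::finite \<Rightarrow> real \<Rightarrow> real. (\<forall>k. class_f \<alpha> (f k)) \<longrightarrow>
           (let F = (\<lambda>x::real^'n. \<Prod>k\<in>UNIV. f k (x $ k)) in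
            W11_norm gauss (\<lambda>x. F x - 1)
              \<le> ennreal (a * real CARD('n) powr (3 / 4) *
                   (root 4 (deficit F) + root 4 (deficit F) ^ 3))))) \<and>
     (\<forall>a>0.
        (\<forall>v. class_u \<alpha> v \<longrightarrow>
           W11_norm gauss_pi (\<lambda>x. v x - 1)
             \<le> ennreal (a * (root 4 (deficit_star v) + deficit_star v))) \<longrightarrow>
        (\<forall>u :: 'n \<Rightarrow> real \<Rightarrow> real. (\<forall>k. class_u \<alpha> (u k)) \<longrightarrow>
           (let U = (\<lambda>x::real^'n. \<Prod>k\<in>UNIV. u k (x $ k)) in
            W11_norm gauss_pi (\<lambda>x. U x - 1)
              \<le> ennreal (real CARD('n) * a *
                   (root 4 (deficit_star U) + deficit_star U)))))"
proof (intro conjI allI impI)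
  fix a :: real and f :: "'n \<Rightarrow> real \<Rightarrow> real"
  assume *: "0 < a" "\<forall>g. class_f \<alpha> g \<longrightarrow>
      W11_norm gauss (\<lambda>x. g x - 1) \<le> ennreal (a * (root 4 (deficit g) + root 4 (deficit g) ^ 3))"
    "\<forall>k. class_f \<alpha> (f k)"
  obtain h :: "real ^ 'n \<Rightarrow> real \<Rightarrow> real" where
    h: "(\<lambda>x::real^'n. \<Prod>k\<in>UNIV. f k (x $ k)) = tensor h" "\<And>b. b \<in> Basis \<Longrightarrow> h b \<in> range f"
    by (rule product_as_tensor[of f]) blast
  then have "class_f \<alpha> (h b)" if "b \<in> Basis" for b using *(3) that by (metis imageE)
  then have "W11_norm gauss (\<lambda>x. tensor h x - 1) \<le> ennreal (a * real DIM(real ^ 'n) powr (3 / 4) *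
    (root 4 (deficit (tensor h)) + root 4 (deficit (tensor h)) ^ 3))"
    using * by (intro W11_product_f) auto
  then show "let F = (\<lambda>x::real^'n. \<Prod>k\<in>UNIV. f k (x $ k)) in
      W11_norm gauss (\<lambda>x. F x - 1) \<le> ennreal (a * real CARD('n) powr (3 / 4) *
        (root 4 (deficit F) + root 4 (deficit F) ^ 3))"
    unfolding h(1) Let_def by simp
next
  fix a :: real and u :: "'n \<Rightarrow> real \<Rightarrow> real"
  assume *: "0 < a" "\<forall>v. class_u \<alpha> v \<longrightarrow>
      W11_norm gauss_pi (\<lambda>x. v x - 1) \<le> ennreal (a * (root 4 (deficit_star v) + deficit_star v))"
    "\<forall>k. class_u \<alpha> (u k)"
  obtain h :: "real ^ 'n \<Rightarrow> real \<Rightarrow> real" where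
    h: "(\<lambda>x::real^'n. \<Prod>k\<in>UNIV. u k (x $ k)) = tensor h" "\<And>b. b \<in> Basis \<Longrightarrow> h b \<in> range u"
    by (rule product_as_tensor[of u]) blast
  then have "class_u \<alpha> (h b)" if "b \<in> Basis" for b using *(3) that by (metis imageE)
  then have "W11_norm gauss_pi (\<lambda>x. tensor h x - 1) \<le> ennreal (real DIM(real ^ 'n) * a *
    (root 4 (deficit_star (tensor h)) + deficit_star (tensor h)))"
    using * by (intro W11_product_u) auto
  then show "let U = (\<lambda>x::real^'n. \<Prod>k\<in>UNIV. u k (x $ k)) in
      W11_norm gauss_pi (\<lambda>x. U x - 1) \<le> ennreal (real CARD('n) * a *
        (root 4 (deficit_star U) + deficit_star U))"
    unfolding h(1) Let_def by simp
qed

end
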